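(* Let $k\ge 2$ be an integer and suppose that there exists a $k$-reptile tetrahedron in $\mathbb{R}^3$. Then $k=m^3$ for some integer $m\ge 2$. In particular, no $k$-reptile tetrahedron exists for $2\le k\le 7$.
   Context: A tetrahedron is a (nondegenerate) $3$-dimensional simplex in $\mathbb{R}^3$, regarded as a closed set. A tetrahedron $S$ is called a $k$-reptile if there are tetrahedra $S_1,\ldots,S_k$ with pairwise disjoint interiors such that $S=S_1\cup\cdots\cup S_k$, and $S_1,\ldots,S_k$ are all mutually congruent and each is similar to $S$. The tiling is not required to be face-to-face. *)

theory Defs
  imports "HOL-Analysis.Analysis"
begin

text \<open>A map of a Euclidean space to itself that multiplies all distances by a fixed \<open>c > 0\<close>
  is automatically bijective, so surjectivity is not required below.  Orientation-reversing
  maps are allowed.\<close>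

definition similar_sets :: "'a::euclidean_space set \<Rightarrow> 'a set \<Rightarrow> bool" where
  "similar_sets S T \<longleftrightarrow>
     (\<exists>c>0. \<exists>f::'a \<Rightarrow> 'a. (\<forall>x y. dist (f x) (f y) = c * dist x y) \<and> f ` S = T)"

definition congruent_sets :: "'a::euclidean_space set \<Rightarrow> 'a set \<Rightarrow> bool" where
  "congruent_sets S T \<longleftrightarrow>
     (\<exists>f::'a \<Rightarrow> 'a. (\<forall>x y. dist (f x) (f y) = dist x y) \<and> f ` S = T)"

definition tetrahedron :: "(real ^ 3) set \<Rightarrow> bool" where
  "tetrahedron S \<longleftrightarrow> 3 simplex S"

definition reptile_tetrahedron :: "nat \<Rightarrow> (real ^ 3) set \<Rightarrow> bool" where
  "reptile_tetrahedron k S \<longleftrightarrow>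
     tetrahedron S \<and>
     (\<exists>T :: nat \<Rightarrow> (real ^ 3) set.
        (\<forall>i<k. tetrahedron (T i)) \<and>
        disjoint_family_on (\<lambda>i. interior (T i)) {..<k} \<and>
        S = (\<Union>i<k. T i) \<and>
        (\<forall>i<k. \<forall>j<k. congruent_sets (T i) (T j)) \<and>
        (\<forall>i<k. similar_sets (T i) S))"

end

theory Submission
  imports Defs
begin

text \<open>
  Suppose that a tetrahedron is tiled by \<open>k\<close> congruent tetrahedra similar to it. Comparing volumes, the
  similarity ratio \<open>c\<close> satisfies \<open>c ^ 3 = k\<close>. The proof compares dihedral angles and edge lengths, after
  Matousek, Safernova and Kyncl.

  Around a general point of an edge, the dihedral angle of the edge is the sum of the dihedral angles of
  the tiles that have this point on an edge of theirs (\<open>edge_angle_sum\<close>). Call a dihedral angle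
  indivisible if it is not a sum of two or more dihedral angles of the tetrahedron. An edge with
  indivisible angle is then partitioned into edges of tiles with the same angle (\<open>edge_length_sum\<close>).
  So \<open>c\<close> times the length of such an edge is a combination, with natural coefficients, of the lengths of
  the edges with that angle. If these lengths take at most two values, \<open>c\<close> is an eigenvalue of an integer
  matrix of size at most two, and as \<open>c ^ 3\<close> is an integer this forces \<open>c\<close> to be an integer and \<open>k\<close> to
  be a cube (\<open>two_lengths_cube\<close>).

  It remains to see that in no tetrahedron every indivisible angle occurs on edges of three
  different lengths. Three such edges with the angle \<open>x\<close> bound a face, meet at a vertex, or form a path.
  The dihedral angles determine the shape of a tetrahedron (\<open>dih_symmetry\<close>), so coincidences among the
  angles give symmetries that make two of the three edges equally long. Hence the other three angles
  are not all equal, \<open>x\<close> is the only indivisible angle, and all angles are multiples of \<open>x\<close>. The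
  inequalities between the three dihedral angles at a vertex (\<open>vertex_ineqs\<close>) restrict the multiples so
  much that one of the forbidden coincidences does occur (\<open>no_face\<close>, \<open>no_vertex\<close>, \<open>no_path\<close>).
\<close>

section \<open>Barycentric coordinates, dihedral angles and edge lengths of a tetrahedron\<close>

lemma four_complement:
  fixes i j :: 4
  assumes "i \<noteq> j"
  obtains k l where "distinct [i, j, k, l]" "UNIV = {i, j, k, l}"
proof -
  have "card (UNIV - {i, j}) = 2"
    using assms by (simp add: card_Diff_subset)
  then obtain k l where "UNIV - {i, j} = {k, l}" "k \<noteq> l" by (auto simp: card_2_iff)
  then have "distinct [i, j, k, l]" "UNIV = {i, j, k, l}" using assms by auto
  then show thesis by (rule that)
qed

lemma four_cover:
  fixes i j k l :: 4
  assumes "distinct [i, j, k, l]"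
  shows "UNIV = {i, j, k, l}"
proof (rule sym, rule card_subset_eq)
  show "card {i, j, k, l} = card (UNIV :: 4 set)" using assms by simp
qed auto

lemma four_exists:
  fixes i j k :: 4
  assumes "distinct [i, j, k]"
  obtains l where "distinct [i, j, k, l]"
proof -
  obtain a b where "distinct [i, j, a, b]" "UNIV = {i, j, a, b}"
    using four_complement[of i j] assms by auto
  moreover from this(2) have "k \<in> {i, j, a, b}" by auto
  ultimately show thesis using assms that[of a] that[of b] by auto
qed

lemma sum_four:
  fixes i j k l :: 4 and f :: "4 \<Rightarrow> 'a::ab_group_add"
  assumes "distinct [i, j, k, l]"
  shows "sum f UNIV = f i + f j + f k + f l"
  unfolding four_cover[OF assms] using assms by simp

text \<open>With gradient \<open>g i\<close> as in the locale below, \<open>bary p g i\<close> is the affine function that is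
  \<open>1\<close> at the vertex \<open>p i\<close> and \<open>0\<close> on the opposite face. A tetrahedron is carried around as the pair
  \<open>(p, g)\<close>, since the inward face normals \<open>g i\<close> determine angles and the vertices \<open>p i\<close> lengths.\<close>

definition bary :: "(4 \<Rightarrow> real^3) \<Rightarrow> (4 \<Rightarrow> real^3) \<Rightarrow> 4 \<Rightarrow> real^3 \<Rightarrow> real" where
  "bary p g i x = 1 + g i \<bullet> (x - p i)"

definition body :: "(4 \<Rightarrow> real^3) \<Rightarrow> (4 \<Rightarrow> real^3) \<Rightarrow> (real^3) set" where
  "body p g = {x. \<forall>i. 0 \<le> bary p g i x}"

text \<open>Faces are numbered by their opposite vertices, and edges by the two faces that contain them.
  As \<open>g i\<close> and \<open>g j\<close> are inward normals, the interior dihedral angle is \<open>pi\<close> minus their angle.\<close>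

definition dih :: "(4 \<Rightarrow> real^3) \<Rightarrow> 4 \<Rightarrow> 4 \<Rightarrow> real" where
  "dih g i j = arccos (- (g i \<bullet> g j) / (norm (g i) * norm (g j)))"

text \<open>The edge common to the faces \<open>i\<close> and \<open>j\<close> has the direction of the cross product of their
  normals. The denominator is, up to sign, the same triple product for any three of the four normals,
  so that this expression is the length of that edge.\<close>

definition edge_len :: "(4 \<Rightarrow> real^3) \<Rightarrow> 4 \<Rightarrow> 4 \<Rightarrow> real" where
  "edge_len g i j = norm (cross3 (g i) (g j)) / \<bar>g 1 \<bullet> cross3 (g 2) (g 3)\<bar>"

locale tetra =
  fixes p g :: "4 \<Rightarrow> real^3"
  assumes sum_g: "sum g UNIV = 0"
    and g_edge: "i \<noteq> j \<Longrightarrow> g i \<bullet> (p i - p j) = 1"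
    and g_span: "(\<And>i. g i \<bullet> v = 0) \<Longrightarrow> v = 0"
begin

lemma g_edge': "i \<noteq> j \<Longrightarrow> g i \<bullet> (p j - p i) = - 1"
  using g_edge[of i j] by (simp add: inner_diff_right)

lemma g_edge0: "i \<noteq> j \<Longrightarrow> i \<noteq> k \<Longrightarrow> g i \<bullet> (p j - p k) = 0"
  using g_edge[of i j] g_edge[of i k] by (simp add: inner_diff_right)

lemma g_last: "distinct [i, j, k, l] \<Longrightarrow> g l = - (g i + g j + g k)"
  using sum_g sum_four[of i j k l g] by (simp add: eq_neg_iff_add_eq_0 add_ac del: minus_add_distrib)

lemma g_span3:
  assumes "distinct [i, j, k]" "g i \<bullet> v = 0" "g j \<bullet> v = 0" "g k \<bullet> v = 0"
  shows "v = 0"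
proof -
  obtain l where d: "distinct [i, j, k, l]" using assms four_exists by blast
  have "g l \<bullet> v = 0" using assms by (simp add: g_last[OF d] inner_add_left inner_diff_left)
  then have "g m \<bullet> v = 0" for m using four_cover[OF d] assms by (metis UNIV_I empty_iff insert_iff)
  then show ?thesis by (rule g_span)
qed

lemma g_nonzero [simp]: "g i \<noteq> 0"
proof
  assume "g i = 0"
  moreover obtain j where "j \<noteq> i" by (metis zero_neq_one)
  ultimately show False using g_edge[of i j] by auto
qed

lemma bary_vertex: "bary p g i (p j) = (if i = j then 1 else 0)"
  by (simp add: bary_def g_edge')

text \<open>The gradients sum to zero, so the sum is constant, and it can be evaluated at a vertex.\<close>

lemma sum_bary: "(\<Sum>i\<in>UNIV. bary p g i x) = 1"
proof -
  have "(\<Sum>i\<in>UNIV. bary p g i x) - (\<Sum>i\<in>UNIV. bary p g i y) = sum g UNIV \<bullet> (x - y)" for y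
    unfolding sum_subtractf[symmetric] inner_sum_left
    by (rule sum.cong) (auto simp: bary_def inner_diff_right)
  from this[of "p 1"] show ?thesis by (simp add: sum_g bary_vertex)
qed

lemma bary_repr: "x = (\<Sum>i\<in>UNIV. bary p g i x *\<^sub>R p i)"
proof -
  have "g j \<bullet> (x - (\<Sum>i\<in>UNIV. bary p g i x *\<^sub>R p i)) = 0" for j
  proof -
    have "x - (\<Sum>i\<in>UNIV. bary p g i x *\<^sub>R p i) = (x - p j) - (\<Sum>i\<in>UNIV. bary p g i x *\<^sub>R (p i - p j))"
      by (simp add: scaleR_diff_right sum_subtractf scaleR_sum_left[symmetric] sum_bary)
    then have "g j \<bullet> (x - (\<Sum>i\<in>UNIV. bary p g i x *\<^sub>R p i))
      = g j \<bullet> (x - p j) - (\<Sum>i\<in>UNIV. bary p g i x * (g j \<bullet> (p i - p j)))"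
      by (simp only: inner_diff_right[of _ "x - p j"] inner_sum_right inner_scaleR_right)
    also have "(\<Sum>i\<in>UNIV. bary p g i x * (g j \<bullet> (p i - p j))) = (\<Sum>i\<in>UNIV. (if i = j then bary p g i x else 0) - bary p g i x)"
      by (rule sum.cong) (auto simp: g_edge')
    also have "\<dots> = bary p g j x - 1"
      by (simp add: sum_subtractf sum_bary)
    finally show ?thesis by (simp add: bary_def)
  qed
  then have "x - (\<Sum>i\<in>UNIV. bary p g i x *\<^sub>R p i) = 0" by (rule g_span)
  then show ?thesis by simp
qed

lemma bary_affine: "bary p g i (x + t *\<^sub>R y) = bary p g i x + t * (g i \<bullet> y)"
  by (simp add: bary_def inner_diff_right inner_add_right)

lemma bary_convex: "bary p g i ((1 - t) *\<^sub>R x + t *\<^sub>R y) = (1 - t) * bary p g i x + t * bary p g i y"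
  by (simp add: bary_def inner_diff_right inner_add_right algebra_simps)

lemma closed_body: "closed (body p g)"
proof -
  have "body p g = (\<Inter>i. {x. 0 \<le> bary p g i x})" by (auto simp: body_def)
  moreover have "closed {x. 0 \<le> bary p g i x}" for i
    unfolding bary_def by (intro closed_Collect_le continuous_intros)
  ultimately show ?thesis by (simp add: closed_INT)
qed

lemma interior_body: "(\<And>i. 0 < bary p g i x) \<Longrightarrow> x \<in> interior (body p g)"
proof (rule interiorI)
  have "open {x. 0 < bary p g i x}" for i
    unfolding bary_def by (intro open_Collect_less continuous_intros)
  then show "open (\<Inter>i. {x. 0 < bary p g i x})" by (intro open_INT) auto
qed (auto simp: body_def less_imp_le)

lemma body_hull: "body p g = convex hull (range p)"
proof
  show "body p g \<subseteq> convex hull (range p)"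
  proof
    fix x assume "x \<in> body p g"
    then have "(\<Sum>i\<in>UNIV. bary p g i x *\<^sub>R p i) \<in> convex hull (range p)"
      by (intro convex_sum) (auto simp: body_def sum_bary convex_convex_hull intro: hull_inc)
    then show "x \<in> convex hull (range p)" using bary_repr by metis
  qed
  have "convex (body p g)"
    unfolding convex_alt body_def by (auto simp: bary_convex)
  then show "convex hull (range p) \<subseteq> body p g"
    by (intro hull_minimal) (auto simp: body_def bary_vertex)
qed

lemma cross_nonzero: "i \<noteq> j \<Longrightarrow> cross3 (g i) (g j) \<noteq> 0"
proof
  assume ij: "i \<noteq> j" and z: "cross3 (g i) (g j) = 0"
  obtain k l where d: "distinct [i, j, k, l]" using four_complement[OF ij] by blast
  have "cross3 (p i - p k) (cross3 (g i) (g j)) = - g j"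
    using d g_edge[of i k] g_edge0[of j i k] by (auto simp: Lagrange inner_commute)
  then show False using z by simp
qed

lemma triple_nonzero:
  assumes "distinct [i, j, k]" shows "g k \<bullet> cross3 (g i) (g j) \<noteq> 0"
proof
  assume "g k \<bullet> cross3 (g i) (g j) = 0"
  then have "cross3 (g i) (g j) = 0"
    using assms by (intro g_span3[of i j k]) (auto simp: dot_cross_self)
  then show False using cross_nonzero assms by simp
qed

text \<open>Permuting the factors changes only the sign, and replacing one normal by the fourth changes
  only the sign because the four normals sum to zero.\<close>

lemma triple_const:
  assumes "distinct [i, j, k]"
  shows "\<bar>g k \<bullet> cross3 (g i) (g j)\<bar> = \<bar>g 1 \<bullet> cross3 (g 2) (g 3)\<bar>"
proof -
  define f where "f i j k = \<bar>g k \<bullet> cross3 (g i) (g j)\<bar>" for i j k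
  have sw: "f i j k = f j i k" for i j k
    unfolding f_def by (subst cross_skew) simp
  have sw': "f i j k = f i k j" for i j k
  proof -
    have "g k \<bullet> cross3 (g i) (g j) = - (g j \<bullet> cross3 (g i) (g k))"
      by (simp add: cross3_simps)
    then show ?thesis by (simp add: f_def)
  qed
  have la: "f i j k = f i j l" if "distinct [i, j, k, l]" for i j k l
    using g_last[OF that] by (simp add: f_def inner_add_left inner_diff_left dot_cross_self)
  have a: "f 1 2 4 = f 1 2 3" "f 1 3 4 = f 1 3 2" "f 2 3 4 = f 2 3 1" by (auto intro!: la)
  have "f i j k = f 2 3 1"
    using exhaust_4[of i] exhaust_4[of j] exhaust_4[of k] assms a
    by (elim disjE; simp add: sw sw')
  then show ?thesis by (simp add: f_def)
qed

text \<open>The vector \<open>v = p k - p l\<close> is orthogonal to \<open>g i\<close> and \<open>g j\<close>, hence parallel to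
  \<open>w = cross3 (g i) (g j)\<close>; its length is then fixed by \<open>g k \<bullet> v = 1\<close>.\<close>

lemma dist_edge_len:
  assumes d: "distinct [i, j, k, l]"
  shows "dist (p k) (p l) = edge_len g i j"
proof -
  define v where "v = p k - p l"
  define w where "w = cross3 (g i) (g j)"
  have w0: "w \<noteq> 0" using d cross_nonzero[of i j] by (simp add: w_def)
  have vi: "v \<bullet> g i = 0" and vj: "v \<bullet> g j = 0" and vk: "g k \<bullet> v = 1"
    using d g_edge0[of i k l] g_edge0[of j k l] g_edge[of k l] by (auto simp: v_def inner_commute)
  have "cross3 v w = 0" by (simp add: w_def Lagrange vi vj)
  then have "cross3 w (cross3 v w) = 0" by simp
  then have e: "(w \<bullet> w) *\<^sub>R v = (w \<bullet> v) *\<^sub>R w" by (simp add: Lagrange)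
  have "w \<bullet> w = (w \<bullet> v) * (g k \<bullet> w)"
    using arg_cong[OF e, of "\<lambda>x. g k \<bullet> x"] by (simp add: vk)
  then have f: "(norm w)\<^sup>2 = \<bar>w \<bullet> v\<bar> * \<bar>g k \<bullet> w\<bar>" 
    by (metis abs_mult abs_power2 power2_norm_eq_inner)
  have "(norm w)\<^sup>2 * norm v = \<bar>w \<bullet> v\<bar> * norm w"
    using arg_cong[OF e, of norm] by (simp add: power2_norm_eq_inner)
  then have "(norm w)\<^sup>2 * norm v * \<bar>g k \<bullet> w\<bar> = (norm w)\<^sup>2 * norm w"
    by (simp only: f mult_ac)
  then have "norm v * \<bar>g k \<bullet> w\<bar> = norm w" using w0 by simp
  moreover have "\<bar>g k \<bullet> w\<bar> = \<bar>g 1 \<bullet> cross3 (g 2) (g 3)\<bar>"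
    unfolding w_def by (rule triple_const) (use d in auto)
  moreover have "\<bar>g k \<bullet> w\<bar> \<noteq> 0" using triple_nonzero[of i j k] d by (simp add: w_def)
  ultimately show ?thesis
    by (simp add: edge_len_def v_def w_def dist_norm field_simps)
qed

lemma cos_bounds:
  assumes "i \<noteq> j"
  shows "\<bar>- (g i \<bullet> g j) / (norm (g i) * norm (g j))\<bar> < 1"
proof -
  have "(norm (cross3 (g i) (g j)))\<^sup>2 > 0" using cross_nonzero[OF assms] by simp
  then have "(g i \<bullet> g j)\<^sup>2 < (norm (g i) * norm (g j))\<^sup>2"
    using norm_cross_dot[of "g i" "g j"] by linarith
  then have "\<bar>g i \<bullet> g j\<bar> < norm (g i) * norm (g j)"
    by (metis abs_le_square_iff abs_mult abs_norm_cancel not_le)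
  then show ?thesis by (simp add: abs_mult)
qed

lemma dih_bounds: "i \<noteq> j \<Longrightarrow> 0 < dih g i j \<and> dih g i j < pi"
  using cos_bounds[of i j] arccos_lt_bounded[of "- (g i \<bullet> g j) / (norm (g i) * norm (g j))"]
  unfolding dih_def by linarith

lemma inner_dih: "i \<noteq> j \<Longrightarrow> g i \<bullet> g j = - norm (g i) * norm (g j) * cos (dih g i j)"
  using cos_bounds[of i j] cos_arccos_abs[of "- (g i \<bullet> g j) / (norm (g i) * norm (g j))"]
  by (simp add: dih_def less_imp_le)

lemma dih_sym: "dih g i j = dih g j i"
  by (simp add: dih_def inner_commute mult.commute)

lemma edge_len_sym: "edge_len g i j = edge_len g j i"
  unfolding edge_len_def by (subst cross_skew) simp

text \<open>Up to a common factor the length of an edge is the product of the sine of its dihedral angle and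
  the areas of its two faces, because the area of a face is proportional to the norm of its normal.\<close>

lemma edge_len_dih: 
  "i \<noteq> j \<Longrightarrow> edge_len g i j = norm (g i) * norm (g j) * sin (dih g i j) / \<bar>g 1 \<bullet> cross3 (g 2) (g 3)\<bar>"
proof -
  assume ij: "i \<noteq> j"
  have "(norm (cross3 (g i) (g j)))\<^sup>2 = (norm (g i) * norm (g j))\<^sup>2 - (g i \<bullet> g j)\<^sup>2"
    using norm_cross_dot[of "g i" "g j"] by linarith
  also have "\<dots> = (norm (g i) * norm (g j) * sin (dih g i j))\<^sup>2"
    unfolding inner_dih[OF ij] power_mult_distrib sin_squared_eq by (simp add: algebra_simps)
  finally have "norm (cross3 (g i) (g j)) = norm (g i) * norm (g j) * sin (dih g i j)"
    using dih_bounds[OF ij] by (subst (asm) power2_eq_iff_nonneg) (auto intro!: mult_nonneg_nonneg sin_ge_zero)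
  then show ?thesis by (simp add: edge_len_def)
qed

lemma edge_len_pos: "i \<noteq> j \<Longrightarrow> 0 < edge_len g i j"
  using cross_nonzero[of i j] triple_nonzero[of 2 3 1] by (simp add: edge_len_def)

text \<open>The relation \<open>sum g UNIV = 0\<close> is the only linear relation between the normals: pairing with
  \<open>p i - p j\<close> isolates the difference of two coefficients.\<close>

lemma kernel:
  assumes "(\<Sum>i\<in>UNIV. c i *\<^sub>R g i) = 0"
  shows "c i = c j"
proof (cases "i = j")
  case False
  obtain k l where d: "distinct [i, j, k, l]" using four_complement[OF False] by blast
  have "(\<Sum>i\<in>UNIV. c i *\<^sub>R g i) \<bullet> (p i - p j) = 0" using assms by simp
  then show ?thesis 
    using g_edge0[of k i j] g_edge0[of l i j] g_edge[of i j] g_edge'[of j i] d 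
    by (auto simp: sum_four[OF d] inner_add_left)
qed simp

text \<open>The dihedral angles determine the shape. A permutation of the faces that respects the angles
  respects the Gram matrix of the unit normals, hence its one-dimensional kernel, which is spanned by
  the vector of norms of the \<open>g i\<close>; so it respects these norms, and with them all edge lengths.\<close>

lemma dih_symmetry:
  assumes s: "bij s" and inv: "\<And>i j. i \<noteq> j \<Longrightarrow> dih g (s i) (s j) = dih g i j"
    and ij: "i \<noteq> j"
  shows "edge_len g (s i) (s j) = edge_len g i j"
proof -
  define a where "a i = norm (g i)" for i
  have a0: "a i > 0" for i by (simp add: a_def)
  have inj: "s i = s j \<longleftrightarrow> i = j" for i j using s by (simp add: bij_is_inj inj_eq)
  have gg: "g i \<bullet> g j / (a i * a j) = g (s i) \<bullet> g (s j) / (a (s i) * a (s j))" for i j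
    using a0[of i] a0[of j] a0[of "s i"] a0[of "s j"] inv[of i j]
    by (cases "i = j") (auto simp: inner_dih inj a_def dot_square_norm power2_eq_square)
  \<comment> \<open>\<open>z\<close> is the relation between the unit normals with permuted coefficients; its norm is that of
    \<open>sum g UNIV\<close>.\<close>
  define z where "z = (\<Sum>i\<in>UNIV. (a (s i) / a i) *\<^sub>R g i)"
  have "z \<bullet> z = (\<Sum>i\<in>UNIV. \<Sum>j\<in>UNIV. a (s i) * a (s j) * (g i \<bullet> g j / (a i * a j)))"
    unfolding z_def inner_sum_left inner_sum_right by (intro sum.cong refl) (simp add: mult_ac inner_commute)
  also have "\<dots> = (\<Sum>i\<in>UNIV. \<Sum>j\<in>UNIV. g (s i) \<bullet> g (s j))"
    using a0 by (intro sum.cong refl, subst gg) (simp add: less_imp_neq[THEN not_sym])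
  also have "\<dots> = (\<Sum>i\<in>UNIV. g (s i)) \<bullet> (\<Sum>i\<in>UNIV. g (s i))"
    by (subst inner_sum_left, subst inner_sum_right) simp
  also have "(\<Sum>i\<in>UNIV. g (s i)) = 0"
    using sum.reindex_bij_betw[of s UNIV UNIV g] s sum_g by simp
  finally have "z = 0" by simp
  then have k: "a (s i) / a i = a (s 1) / a 1" for i
    unfolding z_def by (rule kernel)
  define c where "c = a (s 1) / a 1"
  have c: "a (s i) = c * a i" for i using k[of i] a0[of i] by (simp add: c_def field_simps)
  \<comment> \<open>the factor is \<open>1\<close> since the permutation preserves the sum of the norms\<close>
  have "sum a UNIV = (\<Sum>i\<in>UNIV. a (s i))"
    using sum.reindex_bij_betw[of s UNIV UNIV a] s by simp
  also have "\<dots> = c * sum a UNIV" by (simp add: c sum_distrib_left)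
  finally have "c = 1" using sum_pos[of UNIV a] a0 by simp
  then have "a (s i) = a i" for i using c by simp
  then show ?thesis using ij inv[OF ij] by (simp add: edge_len_dih inj a_def)
qed

text \<open>Three of the normals are independent, so their Gram determinant, the square of the triple
  product, is positive.\<close>

lemma gram_pos:
  assumes d: "distinct [i, j, k]"
  defines "A \<equiv> cos (dih g i j)" and "B \<equiv> cos (dih g j k)" and "C \<equiv> cos (dih g i k)"
  shows "0 < 1 - A\<^sup>2 - B\<^sup>2 - C\<^sup>2 - 2 * A * B * C"
proof -
  have gram: "(z \<bullet> cross3 x y)\<^sup>2 = (x \<bullet> x) * (y \<bullet> y) * (z \<bullet> z) + 2 * (x \<bullet> y) * (y \<bullet> z) * (x \<bullet> z)
     - (x \<bullet> x) * (y \<bullet> z)\<^sup>2 - (y \<bullet> y) * (x \<bullet> z)\<^sup>2 - (z \<bullet> z) * (x \<bullet> y)\<^sup>2" for x y z :: "real^3"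
    by (simp add: cross3_def inner_vec_def sum_3 vector_def power2_eq_square) algebra
  have "0 < (g k \<bullet> cross3 (g i) (g j))\<^sup>2" using triple_nonzero[OF d] by simp
  also have "\<dots> = (norm (g i) * norm (g j) * norm (g k))\<^sup>2 * (1 - A\<^sup>2 - B\<^sup>2 - C\<^sup>2 - 2 * A * B * C)"
    unfolding gram A_def B_def C_def using d
    by (simp add: inner_dih dot_square_norm) (simp add: power2_eq_square algebra_simps)
  finally show ?thesis by (simp add: zero_less_mult_iff)
qed

end

text \<open>The Gram determinant of three unit vectors with pairwise angles \<open>pi - a\<close>, \<open>pi - b\<close>,
  \<open>pi - c\<close>, in product form.\<close>

lemma gram_trig:
  fixes a b c :: real
  shows "1 - (cos a)\<^sup>2 - (cos b)\<^sup>2 - (cos c)\<^sup>2 - 2 * cos a * cos b * cos c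
    = - 4 * cos ((a + b + c) / 2) * cos ((b + c - a) / 2) * cos ((a + c - b) / 2) * cos ((a + b - c) / 2)"
proof -
  have "cos ((a + b + c) / 2) * cos ((b + c - a) / 2) = (cos (b + c) + cos a) / 2"
    by (subst cos_times_cos) (simp add: add_divide_distrib diff_divide_distrib)
  moreover have "cos ((a + c - b) / 2) * cos ((a + b - c) / 2) = (cos a + cos (b - c)) / 2"
    by (subst cos_times_cos) (simp add: add_divide_distrib diff_divide_distrib cos_minus[of "b - c", symmetric])
  ultimately have "- 4 * cos ((a + b + c) / 2) * cos ((b + c - a) / 2) * cos ((a + c - b) / 2) * cos ((a + b - c) / 2)
     = - 4 * ((cos (b + c) + cos a) / 2) * ((cos a + cos (b - c)) / 2)" by (simp only: mult.assoc)
  also have "\<dots> = - (cos (b + c) + cos a) * (cos a + cos (b - c))" by simp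
  also have "\<dots> = - ((cos a)\<^sup>2 + 2 * cos a * cos b * cos c + (cos b * cos c)\<^sup>2 - (sin b)\<^sup>2 * (sin c)\<^sup>2)"
    by (simp add: cos_add cos_diff power2_eq_square algebra_simps)
  also have "\<dots> = 1 - (cos a)\<^sup>2 - (cos b)\<^sup>2 - (cos c)\<^sup>2 - 2 * cos a * cos b * cos c"
    by (simp add: sin_squared_eq power_mult_distrib algebra_simps)
  finally show ?thesis by simp
qed

text \<open>The angles of a spherical triangle. In the product form of the Gram determinant, if
  \<open>a + b + c \<le> pi\<close> all four cosines are nonnegative, and if \<open>b + c \<ge> pi + a\<close> the first two are
  nonpositive and the others nonnegative; either way the determinant has the wrong sign.\<close>

lemma spherical_ineqs:
  fixes a b c :: real
  assumes a: "0 < a" "a < pi" and b: "0 < b" "b < pi" and c: "0 < c" "c < pi"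
    and pos: "0 < 1 - (cos a)\<^sup>2 - (cos b)\<^sup>2 - (cos c)\<^sup>2 - 2 * cos a * cos b * cos c"
  shows "pi < a + b + c" "b + c < pi + a"
proof -
  have P: "cos ((a + b + c) / 2) * cos ((b + c - a) / 2) * cos ((a + c - b) / 2) * cos ((a + b - c) / 2) < 0"
    using pos unfolding gram_trig by linarith
  have nn: "0 \<le> cos x" if "- pi / 2 \<le> x" "x \<le> pi / 2" for x using that by (intro cos_ge_zero) auto
  have np: "cos x \<le> 0" if "pi / 2 \<le> x" "x \<le> 3 * pi / 2" for x
    using nn[of "x - pi"] that by (simp add: cos_diff)
  show 1: "pi < a + b + c"
  proof (rule ccontr)
    assume "\<not> pi < a + b + c"
    then have "0 \<le> cos ((a + b + c) / 2) * cos ((b + c - a) / 2) * cos ((a + c - b) / 2) * cos ((a + b - c) / 2)"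
      using a b c by (intro mult_nonneg_nonneg nn) (auto simp: field_simps)
    with P show False by simp
  qed
  show "b + c < pi + a"
  proof (rule ccontr)
    assume "\<not> b + c < pi + a"
    then have "0 \<le> cos ((a + c - b) / 2)" "0 \<le> cos ((a + b - c) / 2)" 
       "cos ((a + b + c) / 2) \<le> 0" "cos ((b + c - a) / 2) \<le> 0"
      using a b c 1 by (auto intro!: nn np simp: field_simps)
    then have "0 \<le> cos ((a + b + c) / 2) * cos ((b + c - a) / 2) * cos ((a + c - b) / 2) * cos ((a + b - c) / 2)"
      by (intro mult_nonneg_nonneg[of _ "cos ((a + b - c) / 2)"] mult_nonneg_nonneg[of _ "cos ((a + c - b) / 2)"] mult_nonpos_nonpos)
    with P show False by simp
  qed
qed

text \<open>The faces \<open>i\<close>, \<open>j\<close>, \<open>k\<close> meet at a vertex, and the three dihedral angles there are the angles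
  of a spherical triangle.\<close>

lemma (in tetra) vertex_ineqs:
  assumes "distinct [i, j, k]"
  shows "pi < dih g i j + dih g j k + dih g i k" "dih g j k + dih g i k < pi + dih g i j"
  using spherical_ineqs[of "dih g i j" "dih g j k" "dih g i k"] gram_pos[of i j k] 
    dih_bounds[of i j] dih_bounds[of j k] dih_bounds[of i k] assms by auto

section \<open>Partitions of an interval, plane sectors, and cube roots\<close>

text \<open>Integrate the sum of the indicator functions of the intervals, which is \<open>1\<close> almost
  everywhere. This replaces any argument about how the intervals are ordered.\<close>

lemma interval_partition:
  fixes a b :: "'i \<Rightarrow> real"
  assumes M: "finite M" and F: "finite F" and cd: "c \<le> d"
    and sub: "\<And>m. m \<in> M \<Longrightarrow> c \<le> a m \<and> a m \<le> b m \<and> b m \<le> d"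
    and cover: "\<And>t. t \<in> {c..d} - F \<Longrightarrow> \<exists>!m. m \<in> M \<and> a m \<le> t \<and> t \<le> b m"
  shows "(\<Sum>m\<in>M. b m - a m) = d - c"
proof -
  define f where "f t = (\<Sum>m\<in>M. if t \<in> cbox (a m) (b m) then 1 else 0 :: real)" for t
  have "((\<lambda>t. if t \<in> cbox (a m) (b m) then 1 else 0 :: real) has_integral (b m - a m)) (cbox c d)" if "m \<in> M" for m
    using sub[OF that] has_integral_const_real[of "1::real" "a m" "b m"]
    by (intro has_integral_restrict_closed_subinterval) auto
  then have "(f has_integral (\<Sum>m\<in>M. b m - a m)) (cbox c d)"
    unfolding f_def by (intro has_integral_sum M)
  moreover have "(f has_integral (d - c)) (cbox c d)"
  proof (rule has_integral_spike_finite[OF F])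
    show "((\<lambda>t. 1 :: real) has_integral d - c) (cbox c d)"
      using has_integral_const_real[of "1::real" c d] cd by simp
    fix t assume t: "t \<in> cbox c d - F"
    then have "\<exists>!m. m \<in> M \<and> a m \<le> t \<and> t \<le> b m" by (intro cover) auto
    then obtain m where m: "m \<in> M" "a m \<le> t \<and> t \<le> b m"
      and u: "\<And>n. n \<in> M \<Longrightarrow> a n \<le> t \<and> t \<le> b n \<Longrightarrow> n = m" by blast
    have "f t = (\<Sum>n\<in>M. if n = m then 1 else 0)"
      unfolding f_def using m(2) u by (intro sum.cong refl) (metis box_real(2) atLeastAtMost_iff)
    then show "f t = 1" using m M by simp
  qed
  ultimately show ?thesis by (rule has_integral_unique)
qed

lemma polar_upper:
  fixes X Y :: real
  assumes "0 \<le> Y" "X \<noteq> 0 \<or> Y \<noteq> 0"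
  obtains r a where "0 < r" "r\<^sup>2 = X\<^sup>2 + Y\<^sup>2" "0 \<le> a" "a \<le> pi" "X = r * cos a" "Y = r * sin a"
proof -
  define r where "r = sqrt (X\<^sup>2 + Y\<^sup>2)"
  have r: "0 < r" "r\<^sup>2 = X\<^sup>2 + Y\<^sup>2" using assms by (auto simp: r_def sum_power2_gt_zero_iff)
  have xy: "(X / r)\<^sup>2 + (Y / r)\<^sup>2 = 1" 
    unfolding power_divide add_divide_distrib[symmetric] r(2) using r by (metis divide_self less_irrefl power_not_zero r(2))
  have "0 \<le> Y / r" using assms r by simp
  from sincos_total_pi[OF this xy] obtain a where "0 \<le> a" "a \<le> pi" "X / r = cos a" "Y / r = sin a" by auto
  with r show thesis by (intro that[of r a]) (auto simp: field_simps)
qed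

text \<open>A plane sector inside the sector of polar angles from \<open>0\<close> to \<open>th\<close> is again given by an
  interval of polar angles. Its boundary rays, obtained by turning the normals \<open>(A, B)\<close> and \<open>(C, D)\<close>
  by a right angle, lie in the large sector and thus have polar angles \<open>a\<close> and \<open>b\<close> in \<open>{0..th}\<close>, and
  the two linear forms become multiples of \<open>sin (s - a)\<close> and \<open>sin (b - s)\<close>.\<close>

lemma planar_sector_oriented:
  fixes A B C D th :: real
  assumes th: "0 < th" "th < pi" and Delta: "A * D - B * C < 0"
    and sub: "\<And>X Y. 0 \<le> A * X + B * Y \<Longrightarrow> 0 \<le> C * X + D * Y \<Longrightarrow> 0 \<le> Y \<and> 0 \<le> sin th * X - cos th * Y"
  obtains a b where "0 \<le> a" "a < b" "b \<le> th"
    "b - a = arccos (- (A * C + B * D) / (sqrt (A\<^sup>2 + B\<^sup>2) * sqrt (C\<^sup>2 + D\<^sup>2)))"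
    "\<And>s. 0 \<le> s \<Longrightarrow> s \<le> th \<Longrightarrow> (a \<le> s \<and> s \<le> b \<longleftrightarrow> 0 \<le> A * cos s + B * sin s \<and> 0 \<le> C * cos s + D * sin s)"
    "\<And>s. a < s \<Longrightarrow> s < b \<Longrightarrow> 0 < A * cos s + B * sin s \<and> 0 < C * cos s + D * sin s"
proof -
  have s1: "0 \<le> - A" "0 \<le> sin th * B - cos th * (- A)"
    using sub[of B "- A"] Delta by (simp_all add: algebra_simps)
  have s2: "0 \<le> C" "0 \<le> sin th * (- D) - cos th * C"
    using sub[of "- D" C] Delta by (simp_all add: algebra_simps)
  obtain r a where r: "0 < r" "r\<^sup>2 = B\<^sup>2 + (- A)\<^sup>2" and a: "0 \<le> a" "a \<le> pi" and BA: "B = r * cos a" "- A = r * sin a"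
  proof -
    have "B \<noteq> 0 \<or> - A \<noteq> 0" using Delta by auto
    then show ?thesis using polar_upper[OF s1(1)] that by metis
  qed
  obtain q b where q: "0 < q" "q\<^sup>2 = (- D)\<^sup>2 + C\<^sup>2" and b: "0 \<le> b" "b \<le> pi" and DC: "- D = q * cos b" "C = q * sin b"
  proof -
    have "- D \<noteq> 0 \<or> C \<noteq> 0" using Delta by auto
    then show ?thesis using polar_upper[OF s2(1)] that by metis
  qed
  have A: "A = - (r * sin a)" and D: "D = - (q * cos b)" using BA DC by auto
  have H1: "A * cos s + B * sin s = r * sin (s - a)" for s
    unfolding A BA(1) sin_diff by (simp add: algebra_simps)
  have H2: "C * cos s + D * sin s = q * sin (b - s)" for s
    unfolding D DC(2) sin_diff by (simp add: algebra_simps)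
  have upper: "c \<le> th" if c: "0 \<le> c" "c \<le> pi" and p: "0 < p" and "0 \<le> sin th * (p * cos c) - cos th * (p * sin c)" for c p
  proof (rule ccontr)
    assume "\<not> c \<le> th"
    then have "0 < sin (c - th)" using c th by (intro sin_gt_zero) auto
    with p have "0 < p * sin (c - th)" by simp
    with that(4) show False unfolding sin_diff by (simp add: algebra_simps)
  qed
  have a_th: "a \<le> th" using upper[OF a r(1)] s1(2) BA by simp
  have b_th: "b \<le> th" using upper[OF b q(1)] s2(2) DC by simp
  have "0 < r * q * sin (b - a)"
    using Delta unfolding A D BA(1) DC(2) sin_diff by (simp add: algebra_simps)
  then have sba: "0 < sin (b - a)" using mult_pos_pos[OF r(1) q(1)] zero_less_mult_pos by blast
  have ab: "a < b"
  proof (rule ccontr)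
    assume "\<not> a < b"
    then have "0 \<le> sin (a - b)" using a b by (intro sin_ge_zero) auto
    moreover have "sin (a - b) = - sin (b - a)" by (metis minus_diff_eq sin_minus)
    ultimately show False using sba by linarith
  qed
  show thesis
  proof (rule that[of a b])
    have "A * C + B * D = - (r * q * cos (b - a))"
      unfolding A D BA(1) DC(2) cos_diff by (simp add: algebra_simps)
    moreover have "sqrt (A\<^sup>2 + B\<^sup>2) = r" "sqrt (C\<^sup>2 + D\<^sup>2) = q"
      using r q by (auto intro!: real_sqrt_unique simp: algebra_simps)
    ultimately show "b - a = arccos (- (A * C + B * D) / (sqrt (A\<^sup>2 + B\<^sup>2) * sqrt (C\<^sup>2 + D\<^sup>2)))"
      using r q ab a b by (simp add: arccos_cos)
  next
    fix s assume s: "0 \<le> s" "s \<le> th"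
    have sign: "0 \<le> sin x \<longleftrightarrow> 0 \<le> x" if "- pi < x" "x < pi" for x
    proof (cases "0 \<le> x")
      case True then show ?thesis using sin_ge_zero[of x] that by simp
    next
      case False then show ?thesis using sin_gt_zero[of "- x"] that by simp
    qed
    have "0 \<le> sin (s - a) \<longleftrightarrow> a \<le> s"
      using sign[of "s - a"] s a th a_th by linarith
    moreover have "0 \<le> sin (b - s) \<longleftrightarrow> s \<le> b"
      using sign[of "b - s"] s b th b_th by linarith
    ultimately show "a \<le> s \<and> s \<le> b \<longleftrightarrow> 0 \<le> A * cos s + B * sin s \<and> 0 \<le> C * cos s + D * sin s"
      unfolding H1 H2 using r q by (simp add: zero_le_mult_iff)
  next
    fix s assume s: "a < s" "s < b"
    then show "0 < A * cos s + B * sin s \<and> 0 < C * cos s + D * sin s"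
      unfolding H1 H2 using r q a b by (auto intro!: mult_pos_pos sin_gt_zero)
  qed (use a b ab b_th in auto)
qed

text \<open>The opposite orientation is reduced to the previous lemma by exchanging the two normals.\<close>

lemma planar_sector:
  fixes A B C D th :: real
  assumes th: "0 < th" "th < pi" and Delta: "A * D - B * C \<noteq> 0"
    and sub: "\<And>X Y. 0 \<le> A * X + B * Y \<Longrightarrow> 0 \<le> C * X + D * Y \<Longrightarrow> 0 \<le> Y \<and> 0 \<le> sin th * X - cos th * Y"
  obtains a b where "0 \<le> a" "a < b" "b \<le> th"
    "b - a = arccos (- (A * C + B * D) / (sqrt (A\<^sup>2 + B\<^sup>2) * sqrt (C\<^sup>2 + D\<^sup>2)))"
    "\<And>s. 0 \<le> s \<Longrightarrow> s \<le> th \<Longrightarrow> (a \<le> s \<and> s \<le> b \<longleftrightarrow> 0 \<le> A * cos s + B * sin s \<and> 0 \<le> C * cos s + D * sin s)"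
    "\<And>s. a < s \<Longrightarrow> s < b \<Longrightarrow> 0 < A * cos s + B * sin s \<and> 0 < C * cos s + D * sin s"
proof (cases "A * D - B * C < 0")
  case True
  show thesis
    by (rule planar_sector_oriented[OF th True sub]) (assumption | rule that)+
next
  case False
  then have "C * B - D * A < 0" using Delta by (simp add: algebra_simps)
  obtain a b where
    "0 \<le> a" "a < b" "b \<le> th"
    "b - a = arccos (- (C * A + D * B) / (sqrt (C\<^sup>2 + D\<^sup>2) * sqrt (A\<^sup>2 + B\<^sup>2)))"
    "\<And>s. 0 \<le> s \<Longrightarrow> s \<le> th \<Longrightarrow> (a \<le> s \<and> s \<le> b \<longleftrightarrow> 0 \<le> C * cos s + D * sin s \<and> 0 \<le> A * cos s + B * sin s)"
    "\<And>s. a < s \<Longrightarrow> s < b \<Longrightarrow> 0 < C * cos s + D * sin s \<and> 0 < A * cos s + B * sin s"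
  proof (rule planar_sector_oriented[OF th \<open>C * B - D * A < 0\<close>])
    show "0 \<le> C * X + D * Y \<Longrightarrow> 0 \<le> A * X + B * Y \<Longrightarrow> 0 \<le> Y \<and> 0 \<le> sin th * X - cos th * Y" for X Y
      by (rule sub)
  qed (rule that)
  then show thesis by (intro that[of a b]) (simp_all only: mult.commute add.commute conj_commute)
qed

lemma rational_cube_root:
  fixes x :: real
  assumes "x \<in> \<rat>" "0 < x" "x ^ 3 = real k"
  shows "\<exists>m::nat. k = m ^ 3"
proof -
  obtain m n :: nat where mn: "n \<noteq> 0" "\<bar>x\<bar> = real m / real n" "coprime m n"
    using Rats_abs_nat_div_natE[OF assms(1)] by metis
  have "real m = x * real n" using mn assms(2) by (simp add: field_simps)
  then have "real m ^ 3 = real k * real n ^ 3" using assms(3) by (simp add: power_mult_distrib)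
  then have e: "m ^ 3 = k * n ^ 3" by (metis of_nat_eq_iff of_nat_mult of_nat_power)
  then have "n ^ 3 dvd m ^ 3" by simp
  then have "n dvd m" by simp
  then have "n = 1" using mn(3) by (metis coprime_common_divisor_nat dvd_refl nat_dvd_1_iff_1)
  with e show ?thesis by auto
qed

text \<open>Reducing \<open>x ^ 3\<close> by the quadratic equation gives a linear equation for \<open>x\<close>. Either it
  determines \<open>x\<close> as a rational number, or its leading coefficient \<open>s\<^sup>2 - t\<close> vanishes and then
  \<open>k = (- s) ^ 3\<close>.\<close>

lemma quadratic_cube_root:
  fixes x :: real and s t :: int
  assumes pos: "0 < x" and cube: "x ^ 3 = real k" and quad: "x\<^sup>2 = of_int s * x - of_int t"
  shows "\<exists>m::nat. k = m ^ 3"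
proof -
  have "x ^ 3 = x * x\<^sup>2" by (simp add: power3_eq_cube power2_eq_square)
  also have "\<dots> = x * (of_int s * x - of_int t)" by (simp only: quad)
  also have "\<dots> = of_int s * x\<^sup>2 - of_int t * x" by (simp add: algebra_simps power2_eq_square)
  also have "\<dots> = of_int s * (of_int s * x - of_int t) - of_int t * x" by (simp only: quad)
  also have "\<dots> = of_int (s\<^sup>2 - t) * x - of_int (s * t)" by (simp add: algebra_simps power2_eq_square)
  finally have e: "real k = of_int (s\<^sup>2 - t) * x - of_int (s * t)" using cube by simp
  show ?thesis
  proof (cases "s\<^sup>2 - t = 0")
    case True
    then have "real k = of_int (- (s ^ 3))" using e by (simp add: power3_eq_cube power2_eq_square)
    then have "int k = - (s ^ 3)" by linarith
    then have k: "int k = (- s) ^ 3" by simp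
    then have "0 \<le> - s" by (metis of_nat_0_le_iff odd_numeral zero_le_odd_power)
    then have "k = nat (- s) ^ 3" using k by (metis nat_int nat_power_eq)
    then show ?thesis by blast
  next
    case False
    then have "x = (real k + of_int (s * t)) / of_int (s\<^sup>2 - t)" using e 
      by (simp add: field_simps del: of_int_diff of_int_mult)
    then have "x \<in> \<rat>" by (metis Rats_add Rats_divide Rats_of_int Rats_of_nat)
    with pos cube show ?thesis by (intro rational_cube_root)
  qed
qed

text \<open>Here \<open>x\<close> is an eigenvalue of an integer two by two matrix, hence a root of its
  characteristic polynomial.\<close>

lemma two_lengths_cube:
  fixes x u v :: real and a b c d :: nat
  assumes pos: "0 < x" "0 < u" "0 < v" and cube: "x ^ 3 = real k"
    and eq: "x * u = real a * u + real b * v" "x * v = real c * u + real d * v"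
  shows "\<exists>m::nat. k = m ^ 3"
proof (rule quadratic_cube_root[OF pos(1) cube])
  have "(x - real a) * u = real b * v" "(x - real d) * v = real c * u"
    using eq by (simp_all add: algebra_simps)
  then have "((x - real a) * u) * ((x - real d) * v) = (real b * v) * (real c * u)" by simp
  then have "(u * v) * ((x - real a) * (x - real d)) = (u * v) * (real b * real c)" by (simp only: mult_ac)
  then have "(x - real a) * (x - real d) = real b * real c" using pos by simp
  then show "x\<^sup>2 = of_int (int a + int d) * x - of_int (int a * int d - int b * int c)"
    by (simp add: algebra_simps power2_eq_square)
qed

section \<open>Simplices, similarities and volume\<close>

text \<open>The gradients form the dual basis of the edge vectors from the vertex \<open>p 4\<close>, completed by the
  negative of their sum.\<close>

lemma simplex_tetra:
  assumes "3 simplex (S :: (real^3) set)"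
  obtains p g where "tetra p g" "S = body p g"
proof -
  obtain C where C: "\<not> affine_dependent C" "int (card C) = 3 + 1" "S = convex hull C"
    using assms unfolding simplex_def by blast
  then have "card C = card (UNIV :: 4 set)" "finite C" by (auto intro: card_ge_0_finite)
  then obtain p where p: "bij_betw p (UNIV :: 4 set) C"
    using finite_same_card_bij[of "UNIV :: 4 set" C] by auto
  have pC: "p i \<in> C" for i using p by (auto simp: bij_betw_def)
  have pinj: "p i = p j \<longleftrightarrow> i = j" for i j using p by (auto simp: bij_betw_def inj_eq)
  have range: "range p = C" using p by (simp add: bij_betw_def)
  define B where "B = (\<lambda>x. x - p 4) ` (C - {p 4})"
  have indep: "independent B"
    unfolding B_def using C(1) pC[of 4] affine_dependent_iff_dependent2 
    by (metis (no_types, lifting) uminus_add_conv_diff image_cong)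
  have cB: "card B = 3" unfolding B_def using C(2) pC \<open>finite C\<close> 
    by (subst card_image) (auto simp: inj_on_def)
  then have span: "span B = UNIV"
    using indep card_eq_dim[of B UNIV] card_ge_0_finite[of B] cB by auto
  have "\<exists>a. \<forall>j. j \<noteq> 4 \<longrightarrow> a \<bullet> (p j - p 4) = (if j = i then 1 else 0)" for i
  proof -
    obtain f where f: "linear f" "\<forall>x\<in>B. f x = (if x = p i - p 4 then 1 else 0 :: real)"
      using linear_independent_extend[OF indep, of "\<lambda>x. if x = p i - p 4 then 1 else 0 :: real"] by blast
    show ?thesis
    proof (rule exI[of _ "adjoint f 1"], intro allI impI)
      fix j :: 4 assume "j \<noteq> 4"
      then have "p j - p 4 \<in> B" using pC pinj by (auto simp: B_def)
      then show "adjoint f 1 \<bullet> (p j - p 4) = (if j = i then 1 else 0)"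
        using f pinj by (simp add: adjoint_works inner_commute[of "adjoint f 1"])
    qed
  qed
  then obtain a where a: "\<And>i j. j \<noteq> 4 \<Longrightarrow> a i \<bullet> (p j - p 4) = (if j = i then 1 else 0)"
    by metis
  define g where "g i = (if i = 4 then - (a 1 + a 2 + a 3) else a i)" for i
  have "tetra p g"
  proof
    show "sum g UNIV = 0" by (simp add: sum_4 g_def)
    show "g i \<bullet> (p i - p j) = 1" if "i \<noteq> j" for i j
    proof (cases "i = 4")
      case True
      have "(a 1 + a 2 + a 3) \<bullet> (p j - p 4) = 1"
        using that True exhaust_4[of j] a by (auto simp: inner_add_left)
      then show ?thesis using True by (simp add: g_def inner_diff_right inner_diff_left inner_add_left)
    next
      case False
      have "a i \<bullet> (p j - p 4) = 0" using a[of j i] that by (cases "j = 4") auto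
      then show ?thesis using a[OF False, of i] False by (simp add: g_def inner_diff_right)
    qed
    show "v = 0" if v: "\<And>i. g i \<bullet> v = 0" for v
    proof -
      have B: "B = {p 1 - p 4, p 2 - p 4, p 3 - p 4}"
        unfolding B_def range[symmetric] UNIV_4 by (simp add: insert_Diff_if pinj)
      have "v \<in> span B" using span by simp
      then obtain c d e where "v - c *\<^sub>R (p 1 - p 4) - d *\<^sub>R (p 2 - p 4) - e *\<^sub>R (p 3 - p 4) = 0"
        unfolding B by (auto simp: span_breakdown_eq)
      then have v': "v = c *\<^sub>R (p 1 - p 4) + d *\<^sub>R (p 2 - p 4) + e *\<^sub>R (p 3 - p 4)"
        by (simp add: algebra_simps)
      have "a 1 \<bullet> v = c" "a 2 \<bullet> v = d" "a 3 \<bullet> v = e"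
        unfolding v' inner_add_right inner_scaleR_right by (simp_all add: a)
      moreover have "a 1 \<bullet> v = 0" "a 2 \<bullet> v = 0" "a 3 \<bullet> v = 0"
        using v[of 1] v[of 2] v[of 3] by (simp_all add: g_def)
      ultimately have "c = 0" "d = 0" "e = 0" by linarith+
      then show "v = 0" using v' by simp
    qed
  qed
  moreover from this have "S = body p g" using tetra.body_hull range C(3) by simp
  ultimately show thesis by (rule that)
qed

lemma scaling_map:
  fixes f :: "'a::euclidean_space \<Rightarrow> 'a"
  assumes c: "0 < c" and f: "\<And>x y. dist (f x) (f y) = c * dist x y"
  obtains Q where "orthogonal_transformation Q" "\<And>x. f x = c *\<^sub>R Q x + f 0"
proof
  let ?Q = "\<lambda>x. (1 / c) *\<^sub>R (f x - f 0)"
  have "dist (?Q x) (?Q y) = dist x y" for x y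
  proof -
    have "?Q x - ?Q y = (1 / c) *\<^sub>R (f x - f y)" by (simp add: scaleR_diff_right)
    then have "norm (?Q x - ?Q y) = (1 / c) * norm (f x - f y)" using c by simp
    then show ?thesis using c f[of x y] by (simp add: dist_norm)
  qed
  then show "orthogonal_transformation ?Q"
    unfolding orthogonal_transformation_isometry by simp
  show "f x = c *\<^sub>R ?Q x + f 0" for x using c by simp
qed

lemma measure_scaling_image:
  fixes f :: "real^3 \<Rightarrow> real^3"
  assumes c: "0 < c" and f: "\<And>x y. dist (f x) (f y) = c * dist x y" and S: "S \<in> lmeasurable"
  shows "measure lebesgue (f ` S) = c ^ 3 * measure lebesgue S"
proof -
  obtain Q where Q: "orthogonal_transformation Q" "\<And>x. f x = c *\<^sub>R Q x + f 0"
    using scaling_map[OF c f] by blast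
  have "f ` S = (\<lambda>x. c *\<^sub>R x + f 0) ` (Q ` S)"
    unfolding image_image by (rule image_cong[OF refl Q(2)])
  then have "measure lebesgue (f ` S) = \<bar>c\<bar> ^ 3 * measure lebesgue (Q ` S)"
    by (simp add: measure_lebesgue_affine)
  then show ?thesis using c Q(1) S by (simp add: measure_orthogonal_image)
qed

text \<open>The whole structure is pulled back along the similarity: vertices shrink by \<open>c\<close>, gradients
  grow by \<open>c\<close>, and dihedral angles are unchanged.\<close>

lemma (in tetra) similar_preimage:
  assumes c: "0 < c" and f: "\<And>x y. dist (f x) (f y) = c * dist x y" and im: "f ` T = body p g"
  obtains q h where "tetra q h" "T = body q h"
    "\<And>i j. c * dist (q i) (q j) = dist (p i) (p j)" "\<And>i j. dih h i j = dih g i j"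
proof -
  obtain Q where Q: "orthogonal_transformation Q" and fQ: "\<And>x. f x = c *\<^sub>R Q x + f 0"
    using scaling_map[OF c f] by blast
  let ?P = "inv Q"
  have P: "orthogonal_transformation ?P" by (rule orthogonal_transformation_inv[OF Q])
  have PQ: "?P (Q x) = x" "Q (?P x) = x" for x
    using orthogonal_transformation_bij[OF Q] by (auto simp: bij_is_inj bij_is_surj surj_f_inv_f)
  have dot: "?P x \<bullet> y = x \<bullet> Q y" for x y
    using P PQ(1)[of y] unfolding orthogonal_transformation_def by metis
  have linP: "linear ?P" and linQ: "linear Q" using P Q by (auto simp: orthogonal_transformation_linear)
  define q where "q i = ?P ((1 / c) *\<^sub>R (p i - f 0))" for i
  define h where "h i = c *\<^sub>R ?P (g i)" for i
  have fq: "f (q i) = p i" for i using c unfolding fQ[of "q i"] by (simp add: q_def PQ)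
  have hdot: "h i \<bullet> (x - y) = g i \<bullet> (f x - f y)" for i x y
    unfolding fQ[of x] fQ[of y] h_def by (simp add: dot linear_diff[OF linQ] inner_diff_right algebra_simps)
  have bary: "bary q h i x = bary p g i (f x)" for i x
    unfolding bary_def hdot fq ..
  show thesis
  proof (rule that)
    show "tetra q h"
    proof
      have "sum h UNIV = c *\<^sub>R ?P (sum g UNIV)" 
        unfolding h_def linear_sum[OF linP] scaleR_sum_right ..
      then show "sum h UNIV = 0" using sum_g linear_0[OF linP] by simp
      show "h i \<bullet> (q i - q j) = 1" if "i \<noteq> j" for i j
        using g_edge[OF that] by (simp add: hdot fq)
      show "v = 0" if "\<And>i. h i \<bullet> v = 0" for v
      proof -
        have "Q v = 0" using that c by (intro g_span) (simp add: h_def dot)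
        then show ?thesis using PQ(1)[of v] linear_0[OF linP] by simp
      qed
    qed
    have "inj f" 
    proof (rule injI)
      fix x y assume "f x = f y"
      then show "x = y" using f[of x y] c by simp
    qed
    then have "x \<in> T \<longleftrightarrow> f x \<in> body p g" for x
      using im by (metis inj_image_mem_iff)
    then show "T = body q h" by (auto simp: body_def bary)
    show "c * dist (q i) (q j) = dist (p i) (p j)" for i j
      using f[of "q i" "q j"] by (simp add: fq)
    have "h i \<bullet> h j = c\<^sup>2 * (g i \<bullet> g j)" for i j
      using P by (simp add: h_def orthogonal_transformation_def power2_eq_square)
    moreover have "norm (h i) = c * norm (g i)" for i
      using P c by (simp add: h_def orthogonal_transformation_norm)
    ultimately show "dih h i j = dih g i j" for i j
      using c by (simp add: dih_def power2_eq_square)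
  qed
qed

section \<open>A tetrahedron contained in another one, near a point of an edge\<close>

context tetra begin

lemma vertex_eqI:
  assumes "\<And>m. m \<noteq> r \<Longrightarrow> bary p g m x = 0" shows "x = p r"
proof -
  have "bary p g r x = 1" 
    using sum_bary[of x] assms sum.remove[of UNIV r "\<lambda>m. bary p g m x"] by simp
  moreover have "x = (\<Sum>m\<in>UNIV. if m = r then bary p g r x *\<^sub>R p r else 0)"
    using assms by (subst bary_repr) (intro sum.cong, auto)
  ultimately show ?thesis by simp
qed

lemma edge_point:
  assumes d: "distinct [i, j, k, l]" and "bary p g i x = 0" "bary p g j x = 0"
  shows "bary p g k x = 1 - bary p g l x" "x = (1 - bary p g l x) *\<^sub>R p k + bary p g l x *\<^sub>R p l"
proof -
  show k: "bary p g k x = 1 - bary p g l x"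
    using sum_bary[of x] assms sum_four[OF d, of "\<lambda>m. bary p g m x"] by simp
  show "x = (1 - bary p g l x) *\<^sub>R p k + bary p g l x *\<^sub>R p l"
    using bary_repr[of x] assms k sum_four[OF d, of "\<lambda>m. bary p g m x *\<^sub>R p m"] by simp
qed

text \<open>The vectors orthogonal to \<open>g i\<close> and \<open>g j\<close> form the line spanned by the common edge, and two
  vectors of a line are orthogonal only if one of them vanishes.\<close>

lemma perp_line:
  assumes ij: "i \<noteq> j" and v: "g i \<bullet> v = 0" "g j \<bullet> v = 0" and e: "g i \<bullet> e = 0" "g j \<bullet> e = 0" "e \<noteq> 0"
    and "v \<bullet> e = 0"
  shows "v = 0"
proof -
  obtain k l where d: "distinct [i, j, k, l]" using four_complement[OF ij] by blast
  have line: "y = (g k \<bullet> y) *\<^sub>R (p k - p l)" if "g i \<bullet> y = 0" "g j \<bullet> y = 0" for y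
  proof -
    have "y - (g k \<bullet> y) *\<^sub>R (p k - p l) = 0"
      using d that g_edge[of k l] g_edge0[of i k l] g_edge0[of j k l]
      by (intro g_span3[of i j k]) (auto simp: inner_diff_right[of _ y])
    then show ?thesis by simp
  qed
  have "e = (g k \<bullet> e) *\<^sub>R (p k - p l)" "v = (g k \<bullet> v) *\<^sub>R (p k - p l)" using line v e by auto
  then have "v \<bullet> e = (g k \<bullet> v) * (g k \<bullet> e) * ((p k - p l) \<bullet> (p k - p l))"
    by (metis inner_scaleR_left inner_scaleR_right mult.assoc mult.commute)
  moreover have "g k \<bullet> e \<noteq> 0" "p k - p l \<noteq> 0" using line[OF e(1,2)] e(3) by auto
  ultimately have "g k \<bullet> v = 0" using assms(7) by simp
  then show ?thesis using line[OF v] by simp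
qed

lemma eventually_bary_nonneg:
  assumes "0 \<le> bary p g i x" "bary p g i x = 0 \<Longrightarrow> 0 \<le> g i \<bullet> y"
  shows "\<forall>\<^sub>F e in at_right 0. 0 \<le> bary p g i (x + e *\<^sub>R y)"
proof (cases "bary p g i x = 0")
  case True
  then show ?thesis using assms 
    by (auto simp: bary_affine intro: eventually_mono[OF eventually_at_right_less[of 0]])
next
  case False
  have "((\<lambda>e. bary p g i x + e * (g i \<bullet> y)) \<longlongrightarrow> bary p g i x + 0 * (g i \<bullet> y)) (at_right 0)"
    by (intro tendsto_intros)
  then have "\<forall>\<^sub>F e in at_right 0. 0 < bary p g i x + e * (g i \<bullet> y)"
    using False assms(1) by (intro order_tendstoD(1)[of _ "bary p g i x"]) auto
  then show ?thesis by (auto simp: bary_affine elim: eventually_mono)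
qed

lemma eventually_bary_pos:
  assumes "0 \<le> bary p g i x" "bary p g i x = 0 \<Longrightarrow> 0 < g i \<bullet> y"
  shows "\<forall>\<^sub>F e in at_right 0. 0 < bary p g i (x + e *\<^sub>R y)"
proof (cases "bary p g i x = 0")
  case True
  then show ?thesis using assms 
    by (auto simp: bary_affine intro: eventually_mono[OF eventually_at_right_less[of 0]])
next
  case False
  have "((\<lambda>e. bary p g i x + e * (g i \<bullet> y)) \<longlongrightarrow> bary p g i x + 0 * (g i \<bullet> y)) (at_right 0)"
    by (intro tendsto_intros)
  then show ?thesis
    using False assms(1) unfolding bary_affine by (intro order_tendstoD(1)[of _ "bary p g i x"]) auto
qed

lemma eventually_body:
  assumes "x \<in> body p g" "\<And>i. bary p g i x = 0 \<Longrightarrow> 0 \<le> g i \<bullet> y"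
  shows "\<forall>\<^sub>F e in at_right 0. x + e *\<^sub>R y \<in> body p g"
  unfolding body_def mem_Collect_eq
  by (intro eventually_all_finite eventually_bary_nonneg) (use assms in \<open>auto simp: body_def\<close>)

lemma eventually_interior:
  assumes "x \<in> body p g" "\<And>i. bary p g i x = 0 \<Longrightarrow> 0 < g i \<bullet> y"
  shows "\<forall>\<^sub>F e in at_right 0. x + e *\<^sub>R y \<in> interior (body p g)"
proof -
  have "\<forall>\<^sub>F e in at_right 0. \<forall>i. 0 < bary p g i (x + e *\<^sub>R y)"
    by (intro eventually_all_finite eventually_bary_pos) (use assms in \<open>auto simp: body_def\<close>)
  then show ?thesis by (rule eventually_mono) (rule interior_body, blast)
qed

text \<open>An orthonormal frame of the plane orthogonal to an edge in which the polar angles of the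
  tetrahedron, seen from the edge, are those from \<open>0\<close> to the dihedral angle.\<close>

lemma edge_frame:
  assumes ij: "i \<noteq> j"
  obtains u w where "u \<bullet> u = 1" "w \<bullet> w = 1" "u \<bullet> w = 0" "g i = norm (g i) *\<^sub>R w"
    "g j = norm (g j) *\<^sub>R (sin (dih g i j) *\<^sub>R u - cos (dih g i j) *\<^sub>R w)"
proof -
  define c s where "c = cos (dih g i j)" and "s = sin (dih g i j)"
  have s: "s > 0" using dih_bounds[OF ij] by (simp add: s_def sin_gt_zero)
  have cs: "c * c + s * s = 1" using sin_cos_squared_add3 by (simp add: c_def s_def)
  define w where "w = (1 / norm (g i)) *\<^sub>R g i"
  define z where "z = (1 / norm (g j)) *\<^sub>R g j"
  define u where "u = (1 / s) *\<^sub>R (z + c *\<^sub>R w)"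
  have ww: "w \<bullet> w = 1" "z \<bullet> z = 1" by (simp_all add: w_def z_def dot_square_norm power2_eq_square)
  have zw: "z \<bullet> w = - c" using inner_dih[OF ij] 
    by (simp add: w_def z_def c_def inner_commute[of "g j"])
  have uu: "(z + c *\<^sub>R w) \<bullet> (z + c *\<^sub>R w) = s * s"
    using ww zw cs by (simp add: inner_add_left inner_add_right inner_commute[of w z] algebra_simps)
  show thesis
  proof (rule that[of u w])
    show "w \<bullet> w = 1" by fact
    show "u \<bullet> u = 1" using uu s by (simp add: u_def)
    show "u \<bullet> w = 0" using zw ww by (simp add: u_def inner_add_left)
    show "g i = norm (g i) *\<^sub>R w" by (simp add: w_def)
    have "s *\<^sub>R u - c *\<^sub>R w = z" using s by (simp add: u_def)
    then show "g j = norm (g j) *\<^sub>R (sin (dih g i j) *\<^sub>R u - cos (dih g i j) *\<^sub>R w)"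
      by (simp add: z_def c_def s_def)
  qed
qed

end

locale subtetra = big: tetra p g + small: tetra q h
  for p g q h :: "4 \<Rightarrow> real^3" +
  assumes sub: "body q h \<subseteq> body p g"
begin

text \<open>Directions that lead from \<open>x\<close> into the small tetrahedron also lead into the large one.\<close>

lemma tangent_cone_mono:
  assumes x: "x \<in> body q h" and i: "bary p g i x = 0" and y: "\<And>z. bary q h z x = 0 \<Longrightarrow> 0 \<le> h z \<bullet> y"
  shows "0 \<le> g i \<bullet> y"
proof -
  have "\<forall>\<^sub>F e in at_right 0. x + e *\<^sub>R y \<in> body q h"
    using x y by (rule small.eventually_body)
  moreover have "\<forall>\<^sub>F e in at_right 0. (0::real) < e" by (rule eventually_at_right_less)
  ultimately have "\<forall>\<^sub>F e in at_right 0. 0 < e \<and> x + e *\<^sub>R y \<in> body q h"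
    by eventually_elim simp
  then obtain e :: real where "0 < e" "x + e *\<^sub>R y \<in> body q h"
    using eventually_happens[of _ "at_right (0::real)"] trivial_limit_at_right_real by blast
  then have "0 \<le> bary p g i (x + e *\<^sub>R y)" using sub by (auto simp: body_def)
  then show ?thesis using i \<open>0 < e\<close> by (simp add: big.bary_affine zero_le_mult_iff)
qed

text \<open>The tangent cone of the small tetrahedron at \<open>x\<close> lies in a wedge whose only lines are parallel
  to the edge of the large tetrahedron. So \<open>x\<close> cannot be in the interior or inside a face of the
  small tetrahedron, whose tangent cones contain planes, and as it is not a vertex either it is
  inside an edge. The ends of that edge are on the edge of the large tetrahedron because the latter
  is an extreme subset.\<close>

lemma edge_at:
  assumes ij: "i \<noteq> j" and x: "x \<in> body q h" "bary p g i x = 0" "bary p g j x = 0" and nv: "x \<notin> range q"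
  obtains i' j' k' l' where "distinct [i', j', k', l']" "bary q h i' x = 0" "bary q h j' x = 0"
    "0 < bary q h k' x" "0 < bary q h l' x"
    "\<And>m r. m \<in> {i, j} \<Longrightarrow> r \<in> {k', l'} \<Longrightarrow> bary p g m (q r) = 0"
proof -
  have "\<exists>i' j'. i' \<noteq> j' \<and> bary q h i' x = 0 \<and> bary q h j' x = 0"
  proof (rule ccontr)
    assume "\<not> ?thesis"
    then obtain z where z: "\<And>m. bary q h m x = 0 \<Longrightarrow> m = z" by metis
    \<comment> \<open>a direction parallel to the only face that can contain \<open>x\<close>, orthogonal to the large edge\<close>
    obtain k l where d: "distinct [i, j, k, l]" using four_complement[OF ij] by blast
    have "dim {h z, p k - p l} \<le> card {h z, p k - p l}" by (rule dim_le_card') simp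
    also have "\<dots> < DIM(real^3)" using card_insert_le_m1[of 2 "{p k - p l}" "h z"] by simp
    finally obtain v where v: "v \<noteq> 0" "\<And>y. y \<in> span {h z, p k - p l} \<Longrightarrow> orthogonal v y"
      using orthogonal_to_subspace_exists by blast
    have o: "h z \<bullet> v = 0" "v \<bullet> (p k - p l) = 0"
      using v(2)[OF span_base, of "h z"] v(2)[OF span_base, of "p k - p l"]
      by (auto simp: orthogonal_def inner_commute)
    have "0 \<le> g m \<bullet> v" "0 \<le> g m \<bullet> (- v)" if "bary p g m x = 0" for m
      using o z by (auto intro!: tangent_cone_mono[OF x(1) that] dest: z simp del: inner_minus_right) 
        (metis inner_minus_right neg_0_le_iff_le order_refl z)+
    then have "g i \<bullet> v = 0" "g j \<bullet> v = 0" using x by force+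
    moreover have "g i \<bullet> (p k - p l) = 0" "g j \<bullet> (p k - p l) = 0" "p k - p l \<noteq> 0"
      using d big.g_edge0[of i k l] big.g_edge0[of j k l] big.g_edge[of k l] by auto
    ultimately show False using big.perp_line[OF ij] o(2) v(1) by blast
  qed
  then obtain i' j' where z: "i' \<noteq> j'" "bary q h i' x = 0" "bary q h j' x = 0" by blast
  obtain k' l' where d: "distinct [i', j', k', l']" using four_complement[OF z(1)] by blast
  have cov: "m \<in> {i', j', k', l'}" for m using four_cover[OF d] by auto
  have k: "bary q h k' x \<noteq> 0"
  proof
    assume "bary q h k' x = 0"
    then have "bary q h m x = 0" if "m \<noteq> l'" for m using z cov[of m] that by auto
    then have "x = q l'" by (rule small.vertex_eqI)
    with nv show False by simp
  qed
  have l: "bary q h l' x \<noteq> 0"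
  proof
    assume "bary q h l' x = 0"
    then have "bary q h m x = 0" if "m \<noteq> k'" for m using z cov[of m] that by auto
    then have "x = q k'" by (rule small.vertex_eqI)
    with nv show False by simp
  qed
  have kl: "0 < bary q h k' x" "0 < bary q h l' x" using k l x(1) by (auto simp: body_def less_le)
  note ep = small.edge_point[OF d z(2,3)]
  have vb: "q r \<in> body p g" for r using sub by (rule subsetD) (simp add: body_def small.bary_vertex)
  have "bary p g m (q k') = 0 \<and> bary p g m (q l') = 0" if "m \<in> {i, j}" for m
  proof -
    have nn: "0 \<le> bary p g m (q k')" "0 \<le> bary p g m (q l')" using vb by (auto simp: body_def)
    have "0 = bary p g m x" using that x by auto
    also have "\<dots> = bary q h k' x * bary p g m (q k') + bary q h l' x * bary p g m (q l')"
      by (subst ep(2)) (simp only: big.bary_convex ep(1))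
    finally show ?thesis using nn kl
      by (metis add_nonneg_eq_0_iff less_imp_le mult_eq_0_iff mult_nonneg_nonneg order_less_irrefl)
  qed
  with d z kl show thesis by (intro that[of i' j' k' l']) auto
qed

text \<open>Near \<open>x\<close> both tetrahedra are products of the edge direction with a plane sector, and the
  sectors are nested. The small one is an interval of polar angles whose length is the dihedral angle
  of the small tetrahedron.\<close>

lemma sector_at:
  assumes ij: "i \<noteq> j" and d: "distinct [i', j', k', l']" 
    and x: "x \<in> body q h" "bary p g i x = 0" "bary p g j x = 0" 
    and z: "0 < bary q h k' x" "0 < bary q h l' x"
    and e0: "\<And>m r. m \<in> {i, j} \<Longrightarrow> r \<in> {k', l'} \<Longrightarrow> bary p g m (q r) = 0"
    and uw: "u \<bullet> u = 1" "w \<bullet> w = 1" "u \<bullet> w = 0" "g i = norm (g i) *\<^sub>R w"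
      "g j = norm (g j) *\<^sub>R (sin (dih g i j) *\<^sub>R u - cos (dih g i j) *\<^sub>R w)"
  defines "Y \<equiv> \<lambda>s. cos s *\<^sub>R u + sin s *\<^sub>R w"
  obtains a b where "0 \<le> a" "a < b" "b \<le> dih g i j" "b - a = dih h i' j'"
    "\<And>s. 0 \<le> s \<Longrightarrow> s \<le> dih g i j \<Longrightarrow> (a \<le> s \<and> s \<le> b \<longleftrightarrow> 0 \<le> h i' \<bullet> Y s \<and> 0 \<le> h j' \<bullet> Y s)"
    "\<And>s. a < s \<Longrightarrow> s < b \<Longrightarrow> 0 < h i' \<bullet> Y s \<and> 0 < h j' \<bullet> Y s"
proof -
  define e where "e = q k' - q l'"
  have ge: "g i \<bullet> e = 0" "g j \<bullet> e = 0"
    using e0[of i k'] e0[of i l'] e0[of j k'] e0[of j l'] by (auto simp: bary_def e_def inner_diff_right)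
  have he: "h i' \<bullet> e = 0" "h j' \<bullet> e = 0" and e: "e \<noteq> 0"
    using small.g_edge0[of i' k' l'] small.g_edge0[of j' k' l'] small.g_edge[of k' l'] d by (auto simp: e_def)
  have th: "0 < dih g i j" "dih g i j < pi" using big.dih_bounds[OF ij] by auto
  have "norm (g i) * (w \<bullet> e) = 0" using ge(1) uw(4) by (metis inner_scaleR_left)
  then have we: "w \<bullet> e = 0" by simp
  have "norm (g j) * (sin (dih g i j) * (u \<bullet> e) - cos (dih g i j) * (w \<bullet> e)) = 0" 
    using ge(2) uw(5) by (metis inner_scaleR_left inner_diff_left)
  then have ue: "u \<bullet> e = 0" using we th sin_gt_zero[of "dih g i j"] by simp
  have wu: "w \<bullet> u = 0" using uw(3) by (simp add: inner_commute)
  have gi: "g i \<bullet> (X *\<^sub>R u + Z *\<^sub>R w) = norm (g i) * Z" for X Z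
    by (subst uw(4)) (simp add: inner_add_right wu uw(1-3))
  have gj: "g j \<bullet> (X *\<^sub>R u + Z *\<^sub>R w) = norm (g j) * (sin (dih g i j) * X - cos (dih g i j) * Z)" for X Z
    by (subst uw(5)) (simp add: inner_add_right inner_diff_left wu uw(1-3) algebra_simps)
  \<comment> \<open>both face normals at the small edge lie in the plane spanned by the frame\<close>
  have dec: "v = (v \<bullet> u) *\<^sub>R u + (v \<bullet> w) *\<^sub>R w" if "v \<bullet> e = 0" for v
  proof -
    define v' where "v' = v - ((v \<bullet> u) *\<^sub>R u + (v \<bullet> w) *\<^sub>R w)"
    have o: "v' \<bullet> u = 0" "v' \<bullet> w = 0" "v' \<bullet> e = 0"
      using that we ue uw(1-3) wu by (simp_all add: v'_def inner_diff_left inner_add_left)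
    have "g i \<bullet> v' = 0" by (subst uw(4)) (simp add: o inner_commute[of _ v'])
    moreover have "g j \<bullet> v' = 0" by (subst uw(5)) (simp add: o inner_diff_right inner_commute[of _ v'])
    ultimately have "v' = 0" using big.perp_line[OF ij] ge e o(3) by blast
    then show ?thesis by (simp add: v'_def)
  qed
  define A B C D where "A = h i' \<bullet> u" and "B = h i' \<bullet> w" and "C = h j' \<bullet> u" and "D = h j' \<bullet> w"
  have hi: "h i' = A *\<^sub>R u + B *\<^sub>R w" and hj: "h j' = C *\<^sub>R u + D *\<^sub>R w"
    using dec he by (auto simp: A_def B_def C_def D_def)
  have dot: "(a *\<^sub>R u + b *\<^sub>R w) \<bullet> (c *\<^sub>R u + d *\<^sub>R w) = a * c + b * d" for a b c d
    by (simp add: inner_add_left inner_add_right uw(1-3) wu)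
  have Delta: "A * D - B * C \<noteq> 0"
  proof
    assume D0: "A * D - B * C = 0"
    define f where "f = (- B) *\<^sub>R u + A *\<^sub>R w"
    have "h i' \<bullet> f = 0" "h j' \<bullet> f = 0" using D0 unfolding hi hj f_def dot by (auto simp: algebra_simps)
    moreover have "f \<bullet> e = 0" using ue we by (simp add: f_def inner_add_left inner_diff_left)
    ultimately have "f = 0" by (intro small.perp_line[of i' j']) (use he e d in auto)
    then have "(- B) * (- B) + A * A = 0" unfolding f_def by (metis dot inner_zero_left)
    then have "A = 0 \<and> B = 0" by (simp add: sum_squares_eq_zero_iff)
    then have "h i' = 0" using hi by simp
    then show False using small.g_nonzero by blast
  qed
  have bz: "m \<in> {i', j'}" if "bary q h m x = 0" for m
  proof -
    have "m \<in> {i', j', k', l'}" using four_cover[OF d] by auto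
    with that z show ?thesis by auto
  qed
  have cone: "0 \<le> Z \<and> 0 \<le> sin (dih g i j) * X - cos (dih g i j) * Z" 
    if "0 \<le> A * X + B * Z" "0 \<le> C * X + D * Z" for X Z
  proof -
    have "0 \<le> h m \<bullet> (X *\<^sub>R u + Z *\<^sub>R w)" if "m \<in> {i', j'}" for m
      using that \<open>0 \<le> A * X + B * Z\<close> \<open>0 \<le> C * X + D * Z\<close> unfolding insert_iff
      by (auto simp only: hi hj dot)
    then have "0 \<le> g i \<bullet> (X *\<^sub>R u + Z *\<^sub>R w)" "0 \<le> g j \<bullet> (X *\<^sub>R u + Z *\<^sub>R w)"
      using x bz by (auto intro!: tangent_cone_mono)
    then show ?thesis unfolding gi gj by (simp add: zero_le_mult_iff)
  qed
  have HY: "h i' \<bullet> Y s = A * cos s + B * sin s" "h j' \<bullet> Y s = C * cos s + D * sin s" for s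
    unfolding hi hj Y_def dot by auto
  have nn: "norm (h i') = sqrt (A\<^sup>2 + B\<^sup>2)" "norm (h j') = sqrt (C\<^sup>2 + D\<^sup>2)" 
    unfolding norm_eq_sqrt_inner hi hj dot by (simp_all add: power2_eq_square)
  have hh: "h i' \<bullet> h j' = A * C + B * D" unfolding hi hj dot ..
  have dih: "dih h i' j' = arccos (- (A * C + B * D) / (sqrt (A\<^sup>2 + B\<^sup>2) * sqrt (C\<^sup>2 + D\<^sup>2)))"
    unfolding dih_def nn hh ..
  obtain a b where ab: "0 \<le> a" "a < b" "b \<le> dih g i j"
    "b - a = arccos (- (A * C + B * D) / (sqrt (A\<^sup>2 + B\<^sup>2) * sqrt (C\<^sup>2 + D\<^sup>2)))"
    "\<And>s. 0 \<le> s \<Longrightarrow> s \<le> dih g i j \<Longrightarrow>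
      (a \<le> s \<and> s \<le> b \<longleftrightarrow> 0 \<le> A * cos s + B * sin s \<and> 0 \<le> C * cos s + D * sin s)"
    "\<And>s. a < s \<Longrightarrow> s < b \<Longrightarrow> 0 < A * cos s + B * sin s \<and> 0 < C * cos s + D * sin s"
    by (rule planar_sector[OF th Delta cone]) (assumption | rule that)+
  show thesis
    by (rule that[of a b], unfold HY dih) (fact ab)+
qed

end

section \<open>Tilings along an edge\<close>

lemma between_iff:
  fixes u v t :: real
  shows "min u v \<le> t \<and> t \<le> max u v \<longleftrightarrow> (\<exists>s. 0 \<le> s \<and> s \<le> 1 \<and> t = (1 - s) * u + s * v)"
proof -
  have "min u v \<le> t \<and> t \<le> max u v \<longleftrightarrow> t \<in> closed_segment u v"
    by (auto simp: closed_segment_eq_real_ivl)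
  also have "\<dots> \<longleftrightarrow> (\<exists>s. 0 \<le> s \<and> s \<le> 1 \<and> t = (1 - s) * u + s * v)"
    by (auto simp: closed_segment_def)
  finally show ?thesis .
qed

locale tiling = tetra p g for p g :: "4 \<Rightarrow> real^3" +
  fixes K :: "'m set" and q h :: "'m \<Rightarrow> 4 \<Rightarrow> real^3"
  assumes fin: "finite K" and tile: "m \<in> K \<Longrightarrow> tetra (q m) (h m)"
    and cover: "body p g = (\<Union>m\<in>K. body (q m) (h m))"
    and disj: "m \<in> K \<Longrightarrow> n \<in> K \<Longrightarrow> m \<noteq> n \<Longrightarrow> interior (body (q m) (h m)) \<inter> interior (body (q n) (h n)) = {}"
begin

lemma sub: "m \<in> K \<Longrightarrow> subtetra p g (q m) (h m)"
  using tetra_axioms tile cover by (auto simp: subtetra_def subtetra_axioms_def)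

text \<open>Around a point inside an edge that is not a vertex of a tile, the tiles through it occupy
  intervals of polar angles that partition the interval of the large tetrahedron. They cover it since
  nearby points belong to a tile through \<open>x\<close>, and they overlap only in end points since the
  interiors of the tiles are disjoint.\<close>

lemma edge_angle_sum:
  fixes e :: "'m \<Rightarrow> 4 \<times> 4"
  assumes ij: "i \<noteq> j" and x: "x \<in> body p g" "bary p g i x = 0" "bary p g j x = 0"
    and x0: "\<And>z. bary p g z x = 0 \<Longrightarrow> z \<in> {i, j}"
    and nv: "\<And>m. m \<in> K \<Longrightarrow> x \<notin> range (q m)"
    and e: "\<And>m. m \<in> K \<Longrightarrow> x \<in> body (q m) (h m) \<Longrightarrow> {z. bary (q m) (h m) z x = 0} = {fst (e m), snd (e m)}"
  shows "(\<Sum>m\<in>{m \<in> K. x \<in> body (q m) (h m)}. dih (h m) (fst (e m)) (snd (e m))) = dih g i j"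
proof -
  define M where "M = {m \<in> K. x \<in> body (q m) (h m)}"
  define th where "th = dih g i j"
  have th: "0 < th" "th < pi" using dih_bounds[OF ij] by (auto simp: th_def)
  obtain u w where uw: "u \<bullet> u = 1" "w \<bullet> w = 1" "u \<bullet> w = 0" "g i = norm (g i) *\<^sub>R w"
    "g j = norm (g j) *\<^sub>R (sin (dih g i j) *\<^sub>R u - cos (dih g i j) *\<^sub>R w)"
    using edge_frame[OF ij] by blast
  have wu: "w \<bullet> u = 0" using uw(3) by (simp add: inner_commute)
  define Y where "Y s = cos s *\<^sub>R u + sin s *\<^sub>R w" for s
  have gi: "g i \<bullet> Y s = norm (g i) * sin s" for s
    by (subst uw(4)) (simp add: Y_def inner_add_right uw(1-3) wu)
  have gj: "g j \<bullet> Y s = norm (g j) * sin (th - s)" for s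
    by (subst uw(5)) (simp add: Y_def inner_add_right inner_diff_left uw(1-3) wu sin_diff th_def algebra_simps)
  define sector where "sector m a b \<longleftrightarrow> 0 \<le> a \<and> a < b \<and> b \<le> th \<and> b - a = dih (h m) (fst (e m)) (snd (e m)) \<and>
    (\<forall>s. 0 \<le> s \<longrightarrow> s \<le> th \<longrightarrow> (a \<le> s \<and> s \<le> b \<longleftrightarrow> 0 \<le> h m (fst (e m)) \<bullet> Y s \<and> 0 \<le> h m (snd (e m)) \<bullet> Y s)) \<and>
    (\<forall>s. a < s \<longrightarrow> s < b \<longrightarrow> 0 < h m (fst (e m)) \<bullet> Y s \<and> 0 < h m (snd (e m)) \<bullet> Y s)" for m a b
  have "\<exists>a b. sector m a b" if "m \<in> M" for m
  proof -
    have m: "m \<in> K" "x \<in> body (q m) (h m)" using that by (auto simp: M_def)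
    interpret subtetra p g "q m" "h m" by (rule sub[OF m(1)])
    obtain i' j' k' l' where E: "distinct [i', j', k', l']" "bary (q m) (h m) i' x = 0" "bary (q m) (h m) j' x = 0"
      "0 < bary (q m) (h m) k' x" "0 < bary (q m) (h m) l' x"
      "\<And>n r. n \<in> {i, j} \<Longrightarrow> r \<in> {k', l'} \<Longrightarrow> bary p g n (q m r) = 0"
      using edge_at[OF ij m(2) x(2,3) nv[OF m(1)]] by metis
    obtain a b where ab: "0 \<le> a" "a < b" "b \<le> dih g i j" "b - a = dih (h m) i' j'"
      "\<And>s. 0 \<le> s \<Longrightarrow> s \<le> dih g i j \<Longrightarrow> (a \<le> s \<and> s \<le> b \<longleftrightarrow> 0 \<le> h m i' \<bullet> Y s \<and> 0 \<le> h m j' \<bullet> Y s)"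
      "\<And>s. a < s \<Longrightarrow> s < b \<Longrightarrow> 0 < h m i' \<bullet> Y s \<and> 0 < h m j' \<bullet> Y s"
      by (rule sector_at[OF ij E(1) m(2) x(2,3) E(4,5) E(6) uw, folded Y_def]) (assumption | rule that)+
    have "{i', j'} \<subseteq> {fst (e m), snd (e m)}" using e[OF m] E(2,3) by blast
    then have "(fst (e m) = i' \<and> snd (e m) = j') \<or> (fst (e m) = j' \<and> snd (e m) = i')"
      using E(1) by auto
    then show ?thesis
    proof
      assume "fst (e m) = i' \<and> snd (e m) = j'"
      then show ?thesis unfolding sector_def th_def using ab by (intro exI[of _ a] exI[of _ b]) simp
    next
      assume "fst (e m) = j' \<and> snd (e m) = i'"
      then show ?thesis unfolding sector_def th_def using ab small.dih_sym[of i' j'] 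
        by (intro exI[of _ a] exI[of _ b]) (simp add: conj_commute)
    qed
  qed
  then obtain a b where "\<And>m. m \<in> M \<Longrightarrow> sector m (a m) (b m)" by metis
  then have ab: "\<And>m. m \<in> M \<Longrightarrow> 0 \<le> a m" "\<And>m. m \<in> M \<Longrightarrow> a m < b m" "\<And>m. m \<in> M \<Longrightarrow> b m \<le> th" 
    "\<And>m. m \<in> M \<Longrightarrow> b m - a m = dih (h m) (fst (e m)) (snd (e m))"
    "\<And>m s. m \<in> M \<Longrightarrow> 0 \<le> s \<Longrightarrow> s \<le> th \<Longrightarrow> (a m \<le> s \<and> s \<le> b m \<longleftrightarrow> 0 \<le> h m (fst (e m)) \<bullet> Y s \<and> 0 \<le> h m (snd (e m)) \<bullet> Y s)"
    "\<And>m s. m \<in> M \<Longrightarrow> a m < s \<Longrightarrow> s < b m \<Longrightarrow> 0 < h m (fst (e m)) \<bullet> Y s \<and> 0 < h m (snd (e m)) \<bullet> Y s"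
    unfolding sector_def by blast+
  have zero: "z = fst (e m) \<or> z = snd (e m)" if "m \<in> M" "bary (q m) (h m) z x = 0" for m z
    using e[of m] that by (auto simp: M_def)
  have zero': "bary (q m) (h m) (fst (e m)) x = 0" "bary (q m) (h m) (snd (e m)) x = 0" if "m \<in> M" for m
    using e[of m] that by (auto simp: M_def)
  have finM: "finite M" using fin by (simp add: M_def)
  have "(\<Sum>m\<in>M. b m - a m) = th - 0"
  proof (rule interval_partition[OF finM, of "a ` M \<union> b ` M"])
    show "finite (a ` M \<union> b ` M)" using finM by simp
    show "0 \<le> th" using th by simp
    show "0 \<le> a m \<and> a m \<le> b m \<and> b m \<le> th" if "m \<in> M" for m
      using ab(1-3)[OF that] by simp
    fix t assume t: "t \<in> {0..th} - (a ` M \<union> b ` M)"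
    then have t01: "0 \<le> t" "t \<le> th" by auto
    \<comment> \<open>a point near \<open>x\<close> in direction \<open>Y t\<close> lies in some tile, and in none that misses \<open>x\<close>\<close>
    have ev1: "\<forall>\<^sub>F d in at_right 0. x + d *\<^sub>R Y t \<in> body p g"
    proof (rule eventually_body[OF x(1)])
      fix z assume "bary p g z x = 0"
      then have "z = i \<or> z = j" using x0 by blast
      then show "0 \<le> g z \<bullet> Y t" using t01 th by (auto simp: gi gj intro!: mult_nonneg_nonneg sin_ge_zero)
    qed
    let ?C = "\<Union>m\<in>K - M. body (q m) (h m)"
    have "closed ?C" using fin tile by (intro closed_UN) (auto intro: tetra.closed_body)
    then have C: "open (- ?C)" by (rule open_Compl)
    have xC: "x \<in> - ?C" by (auto simp: M_def)
    have "((\<lambda>d. x + d *\<^sub>R Y t) \<longlongrightarrow> x + 0 *\<^sub>R Y t) (at_right 0)" by (intro tendsto_intros)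
    then have "((\<lambda>d. x + d *\<^sub>R Y t) \<longlongrightarrow> x) (at_right 0)" by simp
    from topological_tendstoD[OF this C xC]
    have ev2: "\<forall>\<^sub>F d in at_right 0. x + d *\<^sub>R Y t \<in> - ?C" .
    have "\<forall>\<^sub>F d in at_right 0. (0::real) < d" by (rule eventually_at_right_less)
    with ev1 ev2 have "\<forall>\<^sub>F d in at_right 0. 0 < d \<and> x + d *\<^sub>R Y t \<in> body p g \<and> x + d *\<^sub>R Y t \<in> - ?C"
      by eventually_elim simp
    then obtain d where d: "0 < d" "x + d *\<^sub>R Y t \<in> body p g" "x + d *\<^sub>R Y t \<in> - ?C"
      using eventually_happens[of _ "at_right (0::real)"] trivial_limit_at_right_real by blast
    then obtain m where m: "m \<in> M" "x + d *\<^sub>R Y t \<in> body (q m) (h m)" using cover by blast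
    then have mK: "m \<in> K" by (simp add: M_def)
    have "0 \<le> h m z \<bullet> Y t" if "bary (q m) (h m) z x = 0" for z
    proof -
      have "0 \<le> bary (q m) (h m) z (x + d *\<^sub>R Y t)" using m(2) by (simp add: body_def)
      then show ?thesis using that d(1) by (simp add: tetra.bary_affine[OF tile[OF mK]] zero_le_mult_iff)
    qed
    then have am: "a m \<le> t \<and> t \<le> b m" using ab(5)[OF m(1) t01] zero'[OF m(1)] by blast
    show "\<exists>!m. m \<in> M \<and> a m \<le> t \<and> t \<le> b m"
    proof (rule ex1I[of _ m])
      show "m \<in> M \<and> a m \<le> t \<and> t \<le> b m" using m am by simp
      fix n assume n: "n \<in> M \<and> a n \<le> t \<and> t \<le> b n"
      have int: "\<forall>\<^sub>F d in at_right 0. x + d *\<^sub>R Y t \<in> interior (body (q n) (h n))" if n: "n \<in> M" "a n \<le> t" "t \<le> b n" for n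
      proof (rule tetra.eventually_interior)
        show "tetra (q n) (h n)" "x \<in> body (q n) (h n)" using n tile by (auto simp: M_def)
        have "a n < t" "t < b n" using n t by (auto simp: less_le)
        then show "0 < h n z \<bullet> Y t" if "bary (q n) (h n) z x = 0" for z
          using ab(6)[OF n(1)] zero[OF n(1) that] by auto
      qed
      have "\<forall>\<^sub>F d in at_right 0. x + d *\<^sub>R Y t \<in> interior (body (q m) (h m)) \<inter> interior (body (q n) (h n))"
        using int[of m] int[of n] n m(1) am by (auto elim: eventually_elim2)
      then have "interior (body (q m) (h m)) \<inter> interior (body (q n) (h n)) \<noteq> {}"
        using eventually_happens[of _ "at_right (0::real)"] trivial_limit_at_right_real by blast
      then show "n = m" using disj[of m n] n mK by (auto simp: M_def)
    qed
  qed
  then show ?thesis using ab(4) by (simp add: M_def th_def)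
qed

text \<open>If the dihedral angle of an edge is not a sum of several dihedral angles, then by the previous
  lemma almost every point of the edge is inside just one edge of a tile, and that one has the same
  dihedral angle. So the edge is partitioned by such edges, each of which is \<open>1 / c\<close> times as long
  as an edge of the large tetrahedron with the same dihedral angle.\<close>

lemma edge_length_sum:
  assumes c: "0 < c" and scale: "\<And>m r s. m \<in> K \<Longrightarrow> c * dist (q m r) (q m s) = dist (p r) (p s)"
    and same: "\<And>m r s. m \<in> K \<Longrightarrow> dih (h m) r s = dih g r s"
    and ij: "i \<noteq> j"
    and indiv: "\<And>M. set_mset M \<subseteq> {dih g a b |a b. a \<noteq> b} \<Longrightarrow> sum_mset M = dih g i j \<Longrightarrow> size M \<le> 1"
  obtains n :: "4 \<times> 4 \<Rightarrow> nat" where 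
    "c * edge_len g i j = (\<Sum>e\<in>{(a, b). a \<noteq> b \<and> dih g a b = dih g i j}. real (n e) * edge_len g (fst e) (snd e))"
proof -
  obtain k l where d: "distinct [i, j, k, l]" using four_complement[OF ij] by blast
  define bl where "bl m r = bary p g l (q m r)" for m r
  define lo hi where "lo x = (case x of (m, a, b) \<Rightarrow> Min (bl m ` (UNIV - {a, b})))" 
    and "hi x = (case x of (m, a, b) \<Rightarrow> Max (bl m ` (UNIV - {a, b})))" for x :: "'m \<times> 4 \<times> 4"
  \<comment> \<open>the tile edges of the required angle along the edge; \<open>a < b\<close> lists each only once. Positions
    on the edge are measured by the barycentric coordinate \<open>l\<close>.\<close>
  define N where "N = {(m, a, b). m \<in> K \<and> a < b \<and> dih g a b = dih g i j \<and>
     (\<forall>r. r \<noteq> a \<longrightarrow> r \<noteq> b \<longrightarrow> bary p g i (q m r) = 0 \<and> bary p g j (q m r) = 0)}"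
  have finN: "finite N" by (rule finite_subset[of _ "K \<times> UNIV"]) (auto simp: N_def fin)
  have compl: "UNIV - {a, b} = {k', l'}" if "distinct [a, b, k', l']" for a b k' l' :: 4
    using four_cover[OF that] that by auto
  have lohi: "lo (m, a, b) = min (bl m k') (bl m l')" "hi (m, a, b) = max (bl m k') (bl m l')"
    if "distinct [a, b, k', l']" for m a b k' l'
    by (simp_all add: lo_def hi_def compl[OF that])
  have on_edge: "q m r = (1 - bl m r) *\<^sub>R p k + bl m r *\<^sub>R p l" "0 \<le> bl m r" "bl m r \<le> 1"
    if "m \<in> K" "bary p g i (q m r) = 0" "bary p g j (q m r) = 0" for m r
  proof -
    show "q m r = (1 - bl m r) *\<^sub>R p k + bl m r *\<^sub>R p l"
      unfolding bl_def using edge_point[OF d that(2,3)] by simp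
    have "q m r \<in> body (q m) (h m)" using tetra.bary_vertex[OF tile[OF that(1)]] by (simp add: body_def)
    then have "q m r \<in> body p g" using cover that(1) by blast
    then have "0 \<le> bary p g l (q m r)" "0 \<le> bary p g k (q m r)" by (auto simp: body_def)
    then show "0 \<le> bl m r" "bl m r \<le> 1" using edge_point(1)[OF d that(2,3)] by (auto simp: bl_def)
  qed
  have len: "c * (hi x - lo x) * edge_len g i j = edge_len g (fst (snd x)) (snd (snd x))"
    and bounds: "0 \<le> lo x \<and> lo x \<le> hi x \<and> hi x \<le> 1" if xN: "x \<in> N" for x
  proof -
    obtain m a b where x: "x = (m, a, b)" by (cases x)
    have ab: "a \<noteq> b" and m: "m \<in> K" using xN by (auto simp: x N_def)
    obtain k' l' where d': "distinct [a, b, k', l']" using four_complement[OF ab] by blast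
    have "bary p g i (q m r) = 0 \<and> bary p g j (q m r) = 0" if "r \<in> {k', l'}" for r
      using xN d' that by (auto simp: x N_def)
    then have oe: "q m k' = (1 - bl m k') *\<^sub>R p k + bl m k' *\<^sub>R p l" "q m l' = (1 - bl m l') *\<^sub>R p k + bl m l' *\<^sub>R p l"
      "0 \<le> bl m k'" "bl m k' \<le> 1" "0 \<le> bl m l'" "bl m l' \<le> 1"
      using on_edge[OF m] by blast+
    have "q m k' - q m l' = (bl m l' - bl m k') *\<^sub>R (p k - p l)"
      unfolding oe(1,2) by (simp add: algebra_simps)
    then have "dist (q m k') (q m l') = \<bar>bl m l' - bl m k'\<bar> * dist (p k) (p l)"
      by (simp add: dist_norm)
    then have "dist (q m k') (q m l') = (hi x - lo x) * edge_len g i j"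
      unfolding x lohi[OF d'] dist_edge_len[OF d] by (simp add: max_def min_def)
    then have "c * (hi x - lo x) * edge_len g i j = c * dist (q m k') (q m l')" by simp
    then show "c * (hi x - lo x) * edge_len g i j = edge_len g (fst (snd x)) (snd (snd x))"
      using scale[OF m] dist_edge_len[OF d'] by (simp add: x)
    show "0 \<le> lo x \<and> lo x \<le> hi x \<and> hi x \<le> 1" unfolding x lohi[OF d'] using oe by auto
  qed
  \<comment> \<open>the positions of the vertices of the large tetrahedron and of the tiles\<close>
  define F where "F = {0, 1} \<union> (\<lambda>(m, r). bl m r) ` (K \<times> UNIV)"
  have "(\<Sum>x\<in>N. hi x - lo x) = 1 - 0"
  proof (rule interval_partition[OF finN, of F])
    show "finite F" using fin by (simp add: F_def)
    show "0 \<le> lo x \<and> lo x \<le> hi x \<and> hi x \<le> 1" if "x \<in> N" for x using bounds[OF that] .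
    fix t assume t: "t \<in> {0..1} - F"
    then have t01: "0 < t" "t < 1" by (auto simp: F_def less_le)
    define x where "x = (1 - t) *\<^sub>R p k + t *\<^sub>R p l"
    have bx: "bary p g i x = 0" "bary p g j x = 0" "bary p g k x = 1 - t" "bary p g l x = t"
      using d by (auto simp: x_def bary_convex bary_vertex)
    have cov: "z \<in> {i, j, k, l}" for z using four_cover[OF d] by auto
    have xS: "x \<in> body p g" unfolding body_def mem_Collect_eq
    proof
      fix z show "0 \<le> bary p g z x" using cov[of z] bx t01 by auto
    qed
    have x0: "z \<in> {i, j}" if "bary p g z x = 0" for z using cov[of z] bx t01 that by auto
    have nv: "x \<notin> range (q m)" if "m \<in> K" for m
    proof
      assume "x \<in> range (q m)"
      then obtain r where "x = q m r" by blast
      then have "t = bl m r" using bx(4) by (simp add: bl_def)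
      then have "t \<in> F" using that by (auto simp: F_def)
      then show False using t by simp
    qed
    define Mx where "Mx = {m \<in> K. x \<in> body (q m) (h m)}"
    have "\<exists>e. fst e < snd e \<and> {z. bary (q m) (h m) z x = 0} = {fst e, snd e} \<and>
       (\<forall>r. r \<noteq> fst e \<longrightarrow> r \<noteq> snd e \<longrightarrow> bary p g i (q m r) = 0 \<and> bary p g j (q m r) = 0)" if "m \<in> Mx" for m
    proof -
      have m: "m \<in> K" "x \<in> body (q m) (h m)" using that by (auto simp: Mx_def)
      interpret subtetra p g "q m" "h m" by (rule sub[OF m(1)])
      obtain i' j' k' l' where E: "distinct [i', j', k', l']" "bary (q m) (h m) i' x = 0" "bary (q m) (h m) j' x = 0"
        "0 < bary (q m) (h m) k' x" "0 < bary (q m) (h m) l' x"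
        "\<And>n r. n \<in> {i, j} \<Longrightarrow> r \<in> {k', l'} \<Longrightarrow> bary p g n (q m r) = 0"
        using edge_at[OF ij m(2) bx(1,2) nv[OF m(1)]] by metis
      have cov': "z \<in> {i', j', k', l'}" for z using four_cover[OF E(1)] by auto
      have Z: "{z. bary (q m) (h m) z x = 0} = {i', j'}" using E cov' by force
      have R: "bary p g i (q m r) = 0 \<and> bary p g j (q m r) = 0" if "r \<noteq> i'" "r \<noteq> j'" for r
        using E(6)[of _ r] cov'[of r] that by auto
      have "i' < j' \<or> j' < i'" using E(1) by auto
      then show ?thesis
      proof
        assume "i' < j'" then show ?thesis using Z R by (intro exI[of _ "(i', j')"]) auto
      next
        assume "j' < i'" then show ?thesis using Z R by (intro exI[of _ "(j', i')"]) auto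
      qed
    qed
    then obtain e where e: "\<And>m. m \<in> Mx \<Longrightarrow> fst (e m) < snd (e m)" 
      "\<And>m. m \<in> Mx \<Longrightarrow> {z. bary (q m) (h m) z x = 0} = {fst (e m), snd (e m)}"
      "\<And>m r. m \<in> Mx \<Longrightarrow> r \<noteq> fst (e m) \<Longrightarrow> r \<noteq> snd (e m) \<Longrightarrow> bary p g i (q m r) = 0 \<and> bary p g j (q m r) = 0"
      by metis
    have "(\<Sum>m\<in>Mx. dih (h m) (fst (e m)) (snd (e m))) = dih g i j"
      unfolding Mx_def by (rule edge_angle_sum[OF ij xS bx(1,2) x0 nv]) (use e(2) in \<open>auto simp: Mx_def\<close>)
    then have sum: "(\<Sum>m\<in>Mx. dih g (fst (e m)) (snd (e m))) = dih g i j"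
      using same by (simp add: Mx_def)
    have finMx: "finite Mx" using fin by (simp add: Mx_def)
    have "size (image_mset (\<lambda>m. dih g (fst (e m)) (snd (e m))) (mset_set Mx)) \<le> 1"
    proof (rule indiv)
      have "fst (e m) \<noteq> snd (e m)" if "m \<in> Mx" for m using e(1)[OF that] by auto
      then show "set_mset (image_mset (\<lambda>m. dih g (fst (e m)) (snd (e m))) (mset_set Mx)) \<subseteq> {dih g a b |a b. a \<noteq> b}"
        using finMx by auto
      show "sum_mset (image_mset (\<lambda>m. dih g (fst (e m)) (snd (e m))) (mset_set Mx)) = dih g i j"
        using sum by (simp add: sum_unfold_sum_mset)
    qed
    then have "card Mx \<le> 1" by simp
    moreover have "Mx \<noteq> {}" using sum dih_bounds[OF ij] by auto
    then have "card Mx \<noteq> 0" using finMx by simp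
    ultimately have "card Mx = 1" by linarith
    then obtain m where Mx: "Mx = {m}" by (auto simp: card_1_singleton_iff)
    then have m: "m \<in> Mx" "m \<in> K" "x \<in> body (q m) (h m)" by (auto simp: Mx_def)
    have dm: "dih g (fst (e m)) (snd (e m)) = dih g i j" using sum by (simp add: Mx)
    have emN: "(m, e m) \<in> N" using e(1,3)[OF m(1)] m(2) dm by (cases "e m") (auto simp: N_def)
    have ne: "fst (e m) \<noteq> snd (e m)" using e(1)[OF m(1)] by auto
    obtain k' l' where d': "distinct [fst (e m), snd (e m), k', l']" using four_complement[OF ne] by blast
    interpret sm: tetra "q m" "h m" by (rule tile[OF m(2)])
    have bz: "bary (q m) (h m) (fst (e m)) x = 0" "bary (q m) (h m) (snd (e m)) x = 0" using e(2)[OF m(1)] by auto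
    define s where "s = bary (q m) (h m) l' x"
    have s: "0 \<le> s" "s \<le> 1" using m(3) sm.edge_point(1)[OF d' bz] by (auto simp: s_def body_def) (metis diff_ge_0_iff_ge)
    have "t = (1 - s) * bl m k' + s * bl m l'"
      using bx(4) sm.edge_point(2)[OF d' bz] unfolding s_def[symmetric] bl_def by (metis bary_convex)
    then have tI: "lo (m, e m) \<le> t \<and> t \<le> hi (m, e m)"
      using between_iff[of "bl m k'" "bl m l'" t] s lohi[OF d', of m] by auto
    show "\<exists>!y. y \<in> N \<and> lo y \<le> t \<and> t \<le> hi y"
    proof (rule ex1I[of _ "(m, e m)"])
      show "(m, e m) \<in> N \<and> lo (m, e m) \<le> t \<and> t \<le> hi (m, e m)" using emN tI by simp
      fix y assume y: "y \<in> N \<and> lo y \<le> t \<and> t \<le> hi y"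
      obtain n a b where yn: "y = (n, a, b)" by (cases y)
      have n: "n \<in> K" "a < b" 
        and n0: "\<And>r. r \<noteq> a \<Longrightarrow> r \<noteq> b \<Longrightarrow> bary p g i (q n r) = 0 \<and> bary p g j (q n r) = 0"
        using y by (auto simp: yn N_def)
      obtain k2 l2 where d2: "distinct [a, b, k2, l2]" using four_complement[of a b] n(2) by blast
      interpret sn: tetra "q n" "h n" by (rule tile[OF n(1)])
      have "min (bl n k2) (bl n l2) \<le> t \<and> t \<le> max (bl n k2) (bl n l2)"
        using y by (simp add: yn lohi[OF d2])
      then obtain s' where s': "0 \<le> s'" "s' \<le> 1" "t = (1 - s') * bl n k2 + s' * bl n l2"
        unfolding between_iff by blast
      define z where "z = (1 - s') *\<^sub>R q n k2 + s' *\<^sub>R q n l2"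
      have "bary p g i z = 0" "bary p g j z = 0" "bary p g l z = t"
        using n0[of k2] n0[of l2] d2 s'(3) by (auto simp: z_def bary_convex bl_def)
      then have "z = x" using edge_point(2)[OF d, of z] by (simp add: x_def)
      then have bn: "bary (q n) (h n) r x = (1 - s') * (if r = k2 then 1 else 0) + s' * (if r = l2 then 1 else 0)" for r
        by (auto simp: z_def sn.bary_convex sn.bary_vertex)
      have "x \<in> body (q n) (h n)" using s' by (auto simp: body_def bn)
      then have nm: "n = m" using n(1) Mx by (auto simp: Mx_def)
      have "bary (q n) (h n) a x = 0" "bary (q n) (h n) b x = 0" using d2 by (auto simp: bn)
      then have "{a, b} \<subseteq> {fst (e m), snd (e m)}" using e(2)[OF m(1)] nm by blast
      then have "a = fst (e m)" "b = snd (e m)" using n(2) e(1)[OF m(1)] by auto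
      then show "y = (m, e m)" by (simp add: yn nm)
    qed
  qed simp
  then have "c * edge_len g i j = (\<Sum>x\<in>N. c * (hi x - lo x) * edge_len g i j)"
    by (simp add: sum_distrib_left[symmetric] sum_distrib_right[symmetric])
  also have "\<dots> = (\<Sum>x\<in>N. edge_len g (fst (snd x)) (snd (snd x)))"
    using len by (intro sum.cong) auto
  also have "\<dots> = (\<Sum>e\<in>{(a, b). a \<noteq> b \<and> dih g a b = dih g i j}. \<Sum>x\<in>{x \<in> N. snd x = e}. edge_len g (fst (snd x)) (snd (snd x)))"
    by (rule sum.group[symmetric]) (use finN in \<open>auto simp: N_def\<close>)
  also have "\<dots> = (\<Sum>e\<in>{(a, b). a \<noteq> b \<and> dih g a b = dih g i j}. real (card {x \<in> N. snd x = e}) * edge_len g (fst e) (snd e))"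
    by (intro sum.cong refl) simp
  finally show thesis by (rule that)
qed

end

section \<open>Combinatorics of indivisible dihedral angles\<close>

text \<open>An irreducible element of the additive monoid generated by \<open>V\<close>.\<close>

definition indivisible :: "real set \<Rightarrow> real \<Rightarrow> bool" where
  "indivisible V a \<longleftrightarrow> a \<in> V \<and> (\<forall>M. set_mset M \<subseteq> V \<longrightarrow> sum_mset M = a \<longrightarrow> size M \<le> 1)"

text \<open>By induction on the rank of an element in \<open>V\<close>: one that is not indivisible is a sum of at least
  two, hence smaller, elements.\<close>

lemma multiple_of_unique_indivisible:
  assumes V: "finite V" "\<And>v. v \<in> V \<Longrightarrow> 0 < v" and uniq: "\<And>b. indivisible V b \<Longrightarrow> b = a"
    and v: "v \<in> V"
  shows "\<exists>n::nat. v = real n * a"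
  using v
proof (induction "card {w \<in> V. w < v}" arbitrary: v rule: less_induct)
  case less
  show ?case
  proof (cases "indivisible V v")
    case True
    then have "v = real 1 * a" using uniq by simp
    then show ?thesis by blast
  next
    case False
    then obtain M where M: "set_mset M \<subseteq> V" "sum_mset M = v" "\<not> size M \<le> 1"
      using less.prems unfolding indivisible_def by blast
    have pos: "0 < sum_mset N" if "N \<noteq> {#}" "set_mset N \<subseteq> V" for N
      using that
    proof (induction N)
      case (add y N)
      then show ?case using V(2)[of y] by (cases "N = {#}") (auto intro: add_pos_pos)
    qed simp
    have mult: "\<exists>n::nat. w = real n * a" if w: "w \<in># M" for w
    proof (rule less.hyps)
      obtain N where N: "M = add_mset w N" using w by (metis multi_member_split)
      then have "N \<noteq> {#}" using M(3) by auto
      then have "0 < sum_mset N" using M(1) N by (intro pos) auto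
      then have wv: "w < v" using M(2) N by simp
      show wV: "w \<in> V" using w M(1) by blast
      show "card {u \<in> V. u < w} < card {u \<in> V. u < v}"
        using V(1) wv wV by (intro psubset_card_mono) auto
    qed
    have "\<exists>n::nat. sum_mset N = real n * a" if "\<forall>w\<in>#N. \<exists>n::nat. w = real n * a" for N
      using that
    proof (induction N)
      case empty show ?case by (intro exI[of _ 0]) simp
    next
      case (add y N)
      then obtain n1 n2 :: nat where "sum_mset N = real n1 * a" "y = real n2 * a" by auto
      then have "sum_mset (add_mset y N) = real (n2 + n1) * a" by (simp add: algebra_simps)
      then show ?case by blast
    qed
    then show ?thesis using mult M(2) by blast
  qed
qed

lemma indivisible_exists:
  assumes "finite V" "\<And>v. v \<in> V \<Longrightarrow> 0 < v" "V \<noteq> {}"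
  obtains a where "indivisible V a"
proof -
  obtain v where v: "v \<in> V" using assms by blast
  have "\<exists>a. indivisible V a"
  proof (rule ccontr)
    assume "\<not> ?thesis"
    \<comment> \<open>with no indivisible element at all, any number, such as \<open>0\<close>, can serve as the generator\<close>
    then have "\<exists>n::nat. v = real n * 0"
      using assms v by (intro multiple_of_unique_indivisible[of V]) auto
    then show False using assms(2)[OF v] by simp
  qed
  with that show thesis by blast
qed

text \<open>The multiples of \<open>a\<close> in the open interval from \<open>x - 2 * a\<close> to \<open>x\<close> are at most two, and
  neighbours.\<close>

lemma consecutive_multiples:
  fixes a x :: real and n m :: nat
  assumes a: "0 < a" and n: "x < real n * a + 2 * a" and m: "real m * a < x"
  shows "m < n + 2"
proof (rule ccontr)
  assume "\<not> m < n + 2"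
  then have "real (n + 2) * a \<le> real m * a" using a by (intro mult_right_mono) auto
  with n m show False by (simp add: algebra_simps)
qed

lemma pair_cases:
  fixes i j k l :: 4
  assumes d: "distinct [i, j, k, l]" and ab: "a \<noteq> b"
  shows "{a, b} = {i, j} \<or> {a, b} = {i, k} \<or> {a, b} = {i, l} \<or> {a, b} = {j, k} \<or> {a, b} = {j, l} \<or> {a, b} = {k, l}"
proof -
  have "a = i \<or> a = j \<or> a = k \<or> a = l" "b = i \<or> b = j \<or> b = k \<or> b = l"
    using four_cover[OF d] by blast+
  then show ?thesis using ab by (elim disjE) (simp_all add: doubleton_eq_iff)
qed

context tetra begin

lemma dih_pair: "{a, b} = {c, d} \<Longrightarrow> dih g a b = dih g c d"
  using dih_sym[of a b] by (auto simp: doubleton_eq_iff)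

lemma edge_len_pair: "{a, b} = {c, d} \<Longrightarrow> edge_len g a b = edge_len g c d"
  using edge_len_sym[of a b] by (auto simp: doubleton_eq_iff)

text \<open>Under these hypotheses, exchanging the faces \<open>i\<close> and \<open>j\<close> preserves all dihedral angles.\<close>

lemma swap_symmetry:
  assumes d: "distinct [i, j, k, l]" and eq: "dih g k i = dih g k j" "dih g l i = dih g l j"
  shows "edge_len g k i = edge_len g k j"
proof -
  let ?s = "id(i := j, j := i)"
  have cov: "z \<in> {i, j, k, l}" for z using four_cover[OF d] by auto
  note sym = dih_sym[of j i] dih_sym[of k i] dih_sym[of l i] dih_sym[of k j] dih_sym[of l j] dih_sym[of l k]
  have b: "bij ?s" by (rule involuntory_imp_bij) (use d in auto)
  have inv: "dih g (?s a) (?s b) = dih g a b" if "a \<noteq> b" for a b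
    using cov[of a] cov[of b] that d eq sym by auto
  show ?thesis using dih_symmetry[OF b inv, of k i] d by auto
qed

text \<open>Under these hypotheses, exchanging \<open>i\<close> with \<open>l\<close> and \<open>j\<close> with \<open>k\<close> preserves all dihedral
  angles.\<close>

lemma reversal_symmetry:
  assumes d: "distinct [i, j, k, l]" and eq: "dih g i j = dih g l k" "dih g i k = dih g l j"
  shows "edge_len g i j = edge_len g l k"
proof -
  let ?s = "id(i := l, l := i, j := k, k := j)"
  have cov: "z \<in> {i, j, k, l}" for z using four_cover[OF d] by auto
  note sym = dih_sym[of j i] dih_sym[of k i] dih_sym[of l i] dih_sym[of k j] dih_sym[of l j] dih_sym[of l k]
  have b: "bij ?s" by (rule involuntory_imp_bij) (use d in auto)
  have inv: "dih g (?s a) (?s b) = dih g a b" if "a \<noteq> b" for a b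
    using cov[of a] cov[of b] that d eq sym by auto
  show ?thesis using dih_symmetry[OF b inv, of i j] d by auto
qed

end

text \<open>The situation to be refuted: a tetrahedron in which the edges of every indivisible dihedral
  angle have at least three different lengths.\<close>

locale three_length_classes = tetra p g for p g +
  assumes three: "indivisible {dih g a b |a b. a \<noteq> b} x \<Longrightarrow>
    \<exists>a b. a \<noteq> b \<and> dih g a b = x \<and> edge_len g a b \<noteq> u \<and> edge_len g a b \<noteq> v"
begin

abbreviation "V \<equiv> {dih g a b |a b. a \<noteq> b}"

lemma V: "finite V" "\<And>v. v \<in> V \<Longrightarrow> 0 < v"
proof -
  have "V \<subseteq> (\<lambda>(a, b). dih g a b) ` UNIV" by auto
  then show "finite V" by (rule finite_subset) simp
  show "\<And>v. v \<in> V \<Longrightarrow> 0 < v" using dih_bounds by auto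
qed

text \<open>Three edges of different lengths are needed, and only three are available.\<close>

lemma exhausted_class:
  assumes y: "indivisible V y" 
    and only: "\<And>a b. a \<noteq> b \<Longrightarrow> dih g a b = y \<Longrightarrow> {a, b} = {i1, j1} \<or> {a, b} = {i2, j2} \<or> {a, b} = {i3, j3}"
  shows "dih g i1 j1 = y \<and> dih g i2 j2 = y \<and> dih g i3 j3 = y"
proof -
  have third: "dih g r3 s3 = y" if "\<And>a b. a \<noteq> b \<Longrightarrow> dih g a b = y \<Longrightarrow> {a, b} = {r1, s1} \<or> {a, b} = {r2, s2} \<or> {a, b} = {r3, s3}"
    for r1 s1 r2 s2 r3 s3
  proof -
    obtain a b where ab: "a \<noteq> b" "dih g a b = y" "edge_len g a b \<noteq> edge_len g r1 s1" "edge_len g a b \<noteq> edge_len g r2 s2"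
      using three[OF y] by blast
    from that[OF ab(1,2)] have "{a, b} = {r3, s3}"
    proof (elim disjE)
      assume "{a, b} = {r1, s1}" from edge_len_pair[OF this] ab(3) show ?thesis by simp
    next
      assume "{a, b} = {r2, s2}" from edge_len_pair[OF this] ab(4) show ?thesis by simp
    qed
    from dih_pair[OF this] ab(2) show ?thesis by simp
  qed
  have "dih g i3 j3 = y" by (rule third[of i1 j1 i2 j2]) (rule only)
  moreover have "dih g i2 j2 = y"
  proof (rule third[of i1 j1 i3 j3])
    fix a b assume "a \<noteq> b" "dih g a b = y"
    from only[OF this] show "{a, b} = {i1, j1} \<or> {a, b} = {i3, j3} \<or> {a, b} = {i2, j2}"
      by (elim disjE) simp_all
  qed
  moreover have "dih g i1 j1 = y"
  proof (rule third[of i2 j2 i3 j3])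
    fix a b assume "a \<noteq> b" "dih g a b = y"
    from only[OF this] show "{a, b} = {i2, j2} \<or> {a, b} = {i3, j3} \<or> {a, b} = {i1, j1}"
      by (elim disjE) simp_all
  qed
  ultimately show ?thesis by simp
qed

lemma all_multiples:
  assumes uniq: "\<And>y. indivisible V y \<Longrightarrow> y = x"
  obtains n :: "4 \<Rightarrow> 4 \<Rightarrow> nat" where "\<And>a b. a \<noteq> b \<Longrightarrow> dih g a b = real (n a b) * x"
proof -
  have "\<exists>n::nat. dih g a b = real n * x" if "a \<noteq> b" for a b
    by (rule multiple_of_unique_indivisible[OF V]) (use uniq that in auto)
  then show thesis using that by metis
qed

text \<open>The three edges are the sides of the face \<open>i\<close>. If two of the other angles were equal, a
  symmetry would make two sides equal. So they are different, hence cannot be a second class of an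
  indivisible angle, and all angles are multiples of \<open>x\<close>. At each corner of the face the two angles
  \<open>x\<close> and the third angle have a sum above \<open>pi\<close>, which leaves only two consecutive multiples for the
  three remaining angles.\<close>

lemma no_face:
  assumes d: "distinct [i, j, k, l]" and x: "dih g i j = x" "dih g i k = x" "dih g i l = x"
    and ne: "edge_len g i j \<noteq> edge_len g i k" "edge_len g i j \<noteq> edge_len g i l" "edge_len g i k \<noteq> edge_len g i l"
  shows False
proof -
  note sym = dih_sym[of j i] dih_sym[of k i] dih_sym[of l i] dih_sym[of k j] dih_sym[of l j] dih_sym[of l k]
  have "dih g j k \<noteq> dih g j l" using swap_symmetry[of k l i j] d x ne by auto
  moreover have "dih g k j \<noteq> dih g k l" using swap_symmetry[of j l i k] d x ne by auto
  moreover have "dih g l j \<noteq> dih g l k" using swap_symmetry[of j k i l] d x ne by auto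
  ultimately have dist: "dih g j k \<noteq> dih g j l" "dih g j k \<noteq> dih g k l" "dih g j l \<noteq> dih g k l"
    unfolding sym .
  have uniq: "y = x" if y: "indivisible V y" for y
  proof (rule ccontr)
    assume "y \<noteq> x"
    have "{a, b} = {j, k} \<or> {a, b} = {j, l} \<or> {a, b} = {k, l}" if "a \<noteq> b" "dih g a b = y" for a b
      using pair_cases[OF d that(1)]
      by (elim disjE) (((simp; fail) | (drule dih_pair, simp add: that(2) x \<open>y \<noteq> x\<close>))+)
    from exhausted_class[OF y this] dist show False by simp
  qed
  obtain n where n: "\<And>a b. a \<noteq> b \<Longrightarrow> dih g a b = real (n a b) * x"
    by (rule all_multiples[OF uniq]) (assumption | rule that)+
  have x0: "0 < x" "x < pi" using dih_bounds[of i j] d x by auto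
  have up: "real (n a b) * x < pi" if "a \<noteq> b" for a b using n dih_bounds that by metis
  have low: "pi < real (n j k) * x + 2 * x" "pi < real (n j l) * x + 2 * x" "pi < real (n k l) * x + 2 * x"
    using vertex_ineqs(1)[of i j k] vertex_ineqs(1)[of i j l] vertex_ineqs(1)[of i k l] d x n[of j k] n[of j l] n[of k l] by auto
  have "n j k \<noteq> n j l" "n j k \<noteq> n k l" "n j l \<noteq> n k l" 
    using dist n[of j k] n[of j l] n[of k l] d by auto
  moreover have "n j k < n j l + 2" "n j l < n j k + 2" "n j k < n k l + 2" "n k l < n j k + 2" 
    "n j l < n k l + 2" "n k l < n j l + 2"
    by (rule consecutive_multiples[OF x0(1)], fact low, rule up, use d in simp)+
  ultimately show False by linarith
qed

text \<open>The three edges meet at the vertex \<open>l\<close>. As for a face, the other angles are different multiples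
  of \<open>x\<close>. Now \<open>3 * x > pi\<close>, which leaves only \<open>x\<close> and \<open>2 * x\<close> for the three remaining angles.\<close>

lemma no_vertex:
  assumes d: "distinct [i, j, k, l]" and x: "dih g i j = x" "dih g i k = x" "dih g j k = x"
    and ne: "edge_len g i j \<noteq> edge_len g i k" "edge_len g i j \<noteq> edge_len g j k" "edge_len g i k \<noteq> edge_len g j k"
  shows False
proof -
  note sym = dih_sym[of j i] dih_sym[of k i] dih_sym[of l i] dih_sym[of k j] dih_sym[of l j] dih_sym[of l k]
  note lsym = edge_len_sym[of j i] edge_len_sym[of k i] edge_len_sym[of k j]
  have "dih g l i \<noteq> dih g l j" using swap_symmetry[of i j k l] d x ne unfolding sym lsym by auto
  moreover have "dih g l i \<noteq> dih g l k" using swap_symmetry[of i k j l] d x ne unfolding sym lsym by auto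
  moreover have "dih g l j \<noteq> dih g l k" using swap_symmetry[of j k i l] d x ne unfolding sym lsym by auto
  ultimately have dist: "dih g i l \<noteq> dih g j l" "dih g i l \<noteq> dih g k l" "dih g j l \<noteq> dih g k l"
    unfolding sym .
  have uniq: "y = x" if y: "indivisible V y" for y
  proof (rule ccontr)
    assume "y \<noteq> x"
    have "{a, b} = {i, l} \<or> {a, b} = {j, l} \<or> {a, b} = {k, l}" if "a \<noteq> b" "dih g a b = y" for a b
      using pair_cases[OF d that(1)]
      by (elim disjE) (((simp; fail) | (drule dih_pair, simp add: that(2) x \<open>y \<noteq> x\<close>))+)
    from exhausted_class[OF y this] dist show False by simp
  qed
  obtain n where n: "\<And>a b. a \<noteq> b \<Longrightarrow> dih g a b = real (n a b) * x"
    by (rule all_multiples[OF uniq]) (assumption | rule that)+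
  have x0: "0 < x" "pi < 3 * x" using dih_bounds[of i j] vertex_ineqs(1)[of i j k] d x by auto
  have "0 < n a b \<and> n a b < 3" if "a \<noteq> b" for a b
  proof -
    have "0 < real (n a b) * x" "real (n a b) * x < pi" using n dih_bounds that by metis+
    then show ?thesis using consecutive_multiples[of x pi 1 "n a b"] x0 by (auto simp: zero_less_mult_iff)
  qed
  from this[of i l] this[of j l] this[of k l] have "n i l \<in> {1, 2}" "n j l \<in> {1, 2}" "n k l \<in> {1, 2}"
    using d by auto
  moreover have "n i l \<noteq> n j l" "n i l \<noteq> n k l" "n j l \<noteq> n k l" 
    using dist n[of i l] n[of j l] n[of k l] d by auto
  ultimately show False by auto
qed

text \<open>The three edges form a path. If the angles \<open>i k\<close> and \<open>j l\<close> were equal, reversing the path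
  would be a symmetry; if the angle \<open>i l\<close> were \<open>x\<close>, four edges of angle \<open>x\<close> would form a closed
  path, and exchanging the faces \<open>i\<close> and \<open>k\<close> would be one. So all angles are multiples of \<open>x\<close>, the
  angles \<open>i k\<close> and \<open>j l\<close> are neighbouring multiples, and the inequalities at the end of the path
  where the larger one lies leave only the multiple \<open>x\<close> for the angle \<open>i l\<close>.\<close>

lemma no_path:
  assumes d: "distinct [i, j, k, l]" and x: "dih g i j = x" "dih g j k = x" "dih g k l = x"
    and ne: "edge_len g i j \<noteq> edge_len g j k" "edge_len g i j \<noteq> edge_len g k l" "edge_len g j k \<noteq> edge_len g k l"
  shows False
proof -
  note sym = dih_sym[of j i] dih_sym[of k i] dih_sym[of l i] dih_sym[of k j] dih_sym[of l j] dih_sym[of l k]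
  note lsym = edge_len_sym[of j i] edge_len_sym[of k j] edge_len_sym[of l k] edge_len_sym[of k i] edge_len_sym[of l j]
  have dist: "dih g i k \<noteq> dih g j l"
    using reversal_symmetry[of i j k l] d x ne unfolding sym lsym by auto
  have il: "dih g i l \<noteq> x" 
    using swap_symmetry[of i k j l] d x ne unfolding sym lsym by auto
  have uniq: "y = x" if y: "indivisible V y" for y
  proof (rule ccontr)
    assume "y \<noteq> x"
    have "{a, b} = {i, k} \<or> {a, b} = {j, l} \<or> {a, b} = {i, l}" if "a \<noteq> b" "dih g a b = y" for a b
      using pair_cases[OF d that(1)]
      by (elim disjE) (((simp; fail) | (drule dih_pair, simp add: that(2) x \<open>y \<noteq> x\<close>))+)
    from exhausted_class[OF y this] dist show False by simp
  qed
  obtain n where n: "\<And>a b. a \<noteq> b \<Longrightarrow> dih g a b = real (n a b) * x"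
    by (rule all_multiples[OF uniq]) (assumption | rule that)+
  have x0: "0 < x" using dih_bounds[of i j] d x by auto
  have ik: "dih g i k = real (n i k) * x" and jl: "dih g j l = real (n j l) * x" and il': "dih g i l = real (n i l) * x"
    using n d by auto
  have bd: "real (n i k) * x < pi" "real (n j l) * x < pi" "0 < real (n i l) * x" 
    using dih_bounds[of i k] dih_bounds[of j l] dih_bounds[of i l] d ik jl il' by auto
  have low: "pi < real (n i k) * x + 2 * x" "pi < real (n j l) * x + 2 * x"
    using vertex_ineqs(1)[of i j k] vertex_ineqs(1)[of j k l] d x ik jl by auto
  have up: "real (n i k) * x + real (n i l) * x < pi + x" "real (n j l) * x + real (n i l) * x < pi + x"
    using vertex_ineqs(2)[of k l i] vertex_ineqs(2)[of i j l] d x ik jl il' sym by auto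
  have "n i k \<noteq> n j l" using dist ik jl by auto
  moreover have "n i k < n j l + 2" "n j l < n i k + 2" 
    by (rule consecutive_multiples[OF x0], fact low, fact bd)+
  ultimately have "n i k = n j l + 1 \<or> n j l = n i k + 1" by linarith
  then have "real (n i l) * x < 2 * x"
  proof
    assume "n i k = n j l + 1"
    then have "real (n i k) * x = real (n j l) * x + x" by (simp add: algebra_simps)
    with up low show ?thesis by linarith
  next
    assume "n j l = n i k + 1"
    then have "real (n j l) * x = real (n i k) * x + x" by (simp add: algebra_simps)
    with up low show ?thesis by linarith
  qed
  then have "n i l < 2" using x0 by simp
  moreover have "0 < n i l" using bd(3) x0 by (simp add: zero_less_mult_iff)
  ultimately have "n i l = 1" by simp
  then show False using il il' by simp
qed

text \<open>Two of the edges lie in the face \<open>i\<close>. Depending on the position of the third, the three edges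
  form a face, meet at a vertex, or form a path.\<close>

lemma no_adjacent_pair:
  assumes d: "distinct [i, j, k]" and ab: "a \<noteq> b"
    and x: "dih g i j = x" "dih g i k = x" "dih g a b = x"
    and ne: "edge_len g i j \<noteq> edge_len g i k" "edge_len g i j \<noteq> edge_len g a b" "edge_len g i k \<noteq> edge_len g a b"
  shows False
proof -
  obtain l where d: "distinct [i, j, k, l]" using four_exists[OF d] by blast
  note sym = dih_sym[of j i] dih_sym[of k i] dih_sym[of l i] dih_sym[of k j] dih_sym[of l j] dih_sym[of l k]
  note lsym = edge_len_sym[of j i] edge_len_sym[of k i] edge_len_sym[of l i] edge_len_sym[of k j] edge_len_sym[of l j] edge_len_sym[of l k]
  have il: "dih g i l = x \<Longrightarrow> edge_len g i l \<noteq> edge_len g a b"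
    using no_face[OF d x(1,2)] ne by auto
  have jk: "dih g j k = x \<Longrightarrow> edge_len g j k \<noteq> edge_len g a b"
    using no_vertex[OF d x(1,2)] ne by auto
  have jl: "dih g j l = x \<Longrightarrow> edge_len g j l \<noteq> edge_len g a b"
    using no_path[of k i j l x] d x ne unfolding sym lsym by auto
  have kl: "dih g k l = x \<Longrightarrow> edge_len g k l \<noteq> edge_len g a b"
    using no_path[of j i k l x] d x ne unfolding sym lsym by auto
  have *: "dih g r s = x \<and> edge_len g r s = edge_len g a b" if "{a, b} = {r, s}" for r s
    using dih_pair[OF that] edge_len_pair[OF that] x(3) by simp
  from pair_cases[OF d ab] show False
    by (elim disjE) (drule *, insert ne il jk jl kl, auto)+
qed

lemma no_meeting_pair:
  assumes meet: "{i, j} \<inter> {a, b} \<noteq> {}" and ne: "i \<noteq> j" "a \<noteq> b" "c \<noteq> e"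
    and x: "dih g i j = x" "dih g a b = x" "dih g c e = x"
    and len: "edge_len g i j \<noteq> edge_len g a b" "edge_len g i j \<noteq> edge_len g c e" "edge_len g a b \<noteq> edge_len g c e"
  shows False
proof -
  note sym = dih_sym[of j i] dih_sym[of b a] edge_len_sym[of j i] edge_len_sym[of b a]
  consider "i = a" | "i = b" | "j = a" | "j = b" using meet by auto
  then show False
  proof cases
    case 1 then show ?thesis using no_adjacent_pair[of i j b c e x] ne x len sym by auto
  next
    case 2 then show ?thesis using no_adjacent_pair[of i j a c e x] ne x len sym by auto
  next
    case 3 then show ?thesis using no_adjacent_pair[of j i b c e x] ne x len sym by auto
  next
    case 4 then show ?thesis using no_adjacent_pair[of j i a c e x] ne x len sym by auto
  qed
qed

text \<open>Among three edges of a tetrahedron two have a common face, since an edge has only one opposite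
  edge. So three edges of equal indivisible angle and different lengths are excluded.\<close>

lemma contradiction: False
proof -
  have "dih g 1 2 \<in> V" by (rule CollectI, rule exI[of _ 1], rule exI[of _ 2]) simp
  then obtain x where x: "indivisible V x" using indivisible_exists[OF V] by blast
  obtain i j where 1: "i \<noteq> j" "dih g i j = x" using three[OF x] by blast
  obtain a b where 2: "a \<noteq> b" "dih g a b = x" "edge_len g a b \<noteq> edge_len g i j" 
    using three[OF x, of "edge_len g i j" "edge_len g i j"] by blast
  obtain c e where 3: "c \<noteq> e" "dih g c e = x" "edge_len g c e \<noteq> edge_len g i j" "edge_len g c e \<noteq> edge_len g a b"
    using three[OF x, of "edge_len g i j" "edge_len g a b"] by blast
  show False
  proof (cases "{i, j} \<inter> {a, b} = {} \<and> {i, j} \<inter> {c, e} = {}")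
    case True
    obtain k l where d: "distinct [i, j, k, l]" "UNIV = {i, j, k, l}" using four_complement[OF 1(1)] by blast
    then have "{a, b} \<subseteq> {k, l}" "{c, e} \<subseteq> {k, l}" using True by auto
    then have "{a, b} = {c, e}" using 2(1) 3(1) by auto
    then show False using 3(4) edge_len_sym by (auto simp: doubleton_eq_iff)
  next
    case False
    then show False
      using no_meeting_pair[of i j a b c e x] no_meeting_pair[of i j c e a b x] 1 2 3 by metis
  qed
qed

end

section \<open>Reptile tetrahedra\<close>

lemma sum_two_values:
  fixes L :: "'a \<Rightarrow> real" and n :: "'a \<Rightarrow> nat"
  assumes "finite E" "\<And>e. e \<in> E \<Longrightarrow> L e = u \<or> L e = v"
  shows "\<exists>a b::nat. (\<Sum>e\<in>E. real (n e) * L e) = real a * u + real b * v"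
  using assms
proof (induction E)
  case empty
  show ?case by (intro exI[of _ 0]) simp
next
  case (insert e E)
  then obtain a b where ab: "(\<Sum>e\<in>E. real (n e) * L e) = real a * u + real b * v" by auto
  from insert.prems[of e] consider "L e = u" | "L e = v" by auto
  then show ?case
  proof cases
    case 1
    then have "(\<Sum>e\<in>insert e E. real (n e) * L e) = real (a + n e) * u + real b * v"
      using insert.hyps ab by (simp add: algebra_simps)
    then show ?thesis by blast
  next
    case 2
    then have "(\<Sum>e\<in>insert e E. real (n e) * L e) = real a * u + real (b + n e) * v"
      using insert.hyps ab by (simp add: algebra_simps)
    then show ?thesis by blast
  qed
qed

text \<open>If the edges of some indivisible angle had at most two lengths, the partition of these edges
  would turn \<open>c\<close> into an eigenvalue of an integer two by two matrix. If \<open>k\<close> is not a cube, every such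
  angle therefore has edges of three lengths, which is impossible.\<close>

lemma (in tiling) cube_of_scaling_tiling:
  assumes c: "0 < c" "c ^ 3 = real k" and scale: "\<And>m r s. m \<in> K \<Longrightarrow> c * dist (q m r) (q m s) = dist (p r) (p s)"
    and same: "\<And>m r s. m \<in> K \<Longrightarrow> dih (h m) r s = dih g r s"
  shows "\<exists>m::nat. k = m ^ 3"
proof (rule ccontr)
  assume nocube: "\<not> ?thesis"
  have "three_length_classes p g"
  proof
    fix x u v
    assume x: "indivisible {dih g a b |a b. a \<noteq> b} x"
    show "\<exists>a b. a \<noteq> b \<and> dih g a b = x \<and> edge_len g a b \<noteq> u \<and> edge_len g a b \<noteq> v"
    proof (rule ccontr)
      assume no: "\<not> ?thesis"
      define C where "C = {(a, b). a \<noteq> b \<and> dih g a b = x}"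
      define L where "L e = edge_len g (fst e) (snd e)" for e
      have finC: "finite C" by (rule finite_subset[of _ UNIV]) auto
      have uv: "L e = u \<or> L e = v" if "e \<in> C" for e 
        using no that unfolding C_def L_def by (cases e) force
      obtain e1 where e1: "e1 \<in> C" using x by (auto simp: indivisible_def C_def)
      \<comment> \<open>if there is only one length, both lengths are taken to be the same\<close>
      obtain e2 where e2: "e2 \<in> C" and both: "\<And>e. e \<in> C \<Longrightarrow> L e = L e1 \<or> L e = L e2"
      proof (cases "\<exists>e\<in>C. L e \<noteq> L e1")
        case True
        then obtain e where "e \<in> C" "L e \<noteq> L e1" by blast
        with uv[OF e1] uv[of e] uv show ?thesis by (intro that[of e]) metis+
      next
        case False
        then show ?thesis using e1 that by blast
      qed
      have row: "\<exists>a b::nat. c * L e = real a * L e1 + real b * L e2" if "e \<in> C" for e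
      proof -
        obtain i j where e: "e = (i, j)" by (cases e)
        have ij: "i \<noteq> j" "dih g i j = x" using that by (auto simp: C_def e)
        have ind: "size M \<le> 1" if "set_mset M \<subseteq> {dih g a b |a b. a \<noteq> b}" "sum_mset M = dih g i j" for M
          using x that unfolding indivisible_def ij(2) by blast
        obtain n :: "4 \<times> 4 \<Rightarrow> nat" where 
          "c * edge_len g i j = (\<Sum>e\<in>{(a, b). a \<noteq> b \<and> dih g a b = dih g i j}. real (n e) * edge_len g (fst e) (snd e))"
          by (rule edge_length_sum[OF c(1) scale same ij(1) ind])
        then have sum: "c * L e = (\<Sum>e\<in>C. real (n e) * L e)" by (simp add: L_def C_def e ij(2))
        show ?thesis unfolding sum by (rule sum_two_values[OF finC both])
      qed
      have pos: "0 < L e" if "e \<in> C" for e using that edge_len_pos by (auto simp: C_def L_def)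
      obtain a1 b1 a2 b2 :: nat where "c * L e1 = real a1 * L e1 + real b1 * L e2" "c * L e2 = real a2 * L e1 + real b2 * L e2"
        using row[OF e1] row[OF e2] by blast
      from two_lengths_cube[OF c(1) pos[OF e1] pos[OF e2] c(2) this] nocube show False by blast
    qed
  qed
  then show False by (rule three_length_classes.contradiction)
qed

text \<open>Congruent tiles have equal volumes, so all similarities between tiles and the whole have the same
  ratio \<open>c\<close>, with \<open>c ^ 3 = real k\<close>.\<close>

lemma reptile_count_is_cube:
  assumes k: "2 \<le> k" and S: "reptile_tetrahedron k S"
  shows "\<exists>m::nat. k = m ^ 3"
proof -
  have simp: "3 simplex S" using S by (simp add: reptile_tetrahedron_def tetrahedron_def)
  obtain T where T: "\<And>m. m < k \<Longrightarrow> tetrahedron (T m)" 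
    "disjoint_family_on (\<lambda>m. interior (T m)) {..<k}" "S = (\<Union>m<k. T m)"
    "\<And>m n. m < k \<Longrightarrow> n < k \<Longrightarrow> congruent_sets (T m) (T n)" "\<And>m. m < k \<Longrightarrow> similar_sets (T m) S"
    using S unfolding reptile_tetrahedron_def by blast
  obtain p g where tet: "tetra p g" and Sb: "S = body p g" using simplex_tetra[OF simp] by blast
  interpret tetra p g by (rule tet)
  obtain C where C: "\<not> affine_dependent C" "int (card C) = 3 + 1" "S = convex hull C"
    using simp unfolding simplex_def by blast
  have comp: "compact (T m)" and conv: "convex (T m)" if m: "m < k" for m
  proof -
    obtain D where "\<not> affine_dependent D" "T m = convex hull D"
      using T(1)[OF m] unfolding tetrahedron_def simplex_def by blast
    then show "compact (T m)" "convex (T m)"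
      by (auto intro: compact_convex_hull finite_imp_compact aff_independent_finite)
  qed
  have meas: "T m \<in> lmeasurable" if "m < k" for m using comp[OF that] by (rule lmeasurable_compact)
  obtain a f where af: "\<And>m. m < k \<Longrightarrow> 0 < a m" "\<And>m x y. m < k \<Longrightarrow> dist (f m x) (f m y) = a m * dist x y"
    "\<And>m. m < k \<Longrightarrow> f m ` T m = S"
    using T(5) unfolding similar_sets_def by metis
  define v where "v = measure lebesgue (T 0)"
  have v: "measure lebesgue (T m) = v" if m: "m < k" for m
  proof -
    obtain f where f: "\<And>x y. dist (f x) (f y) = dist x y" "f ` T 0 = T m"
      using T(4)[of 0 m] m k unfolding congruent_sets_def by auto
    then show ?thesis using measure_scaling_image[of 1 f "T 0"] meas[of 0] k by (simp add: v_def)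
  qed
  have "measure lebesgue S = (\<Sum>m<k. measure lebesgue (T m))"
    unfolding T(3)
  proof (rule measure_negligible_finite_Union_image)
    show "pairwise (\<lambda>m n. negligible (T m \<inter> T n)) {..<k}"
    proof (rule pairwiseI)
      fix m n assume mn: "m \<in> {..<k}" "n \<in> {..<k}" "m \<noteq> n"
      then have "interior (T m \<inter> T n) = {}" using T(2) by (auto simp: disjoint_family_on_def)
      then show "negligible (T m \<inter> T n)" using mn conv by (subst negligible_convex_interior) (auto intro: convex_Int)
    qed
  qed (use meas in auto)
  then have Sv: "measure lebesgue S = real k * v" using v by simp
  have "interior S \<noteq> {}"
    using C(1,2) interior_convex_hull_eq_empty[of C] unfolding C(3) by auto
  moreover have "convex S" unfolding C(3) by (rule convex_convex_hull)
  ultimately have "\<not> negligible S" by (simp add: negligible_convex_interior)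
  moreover have "S \<in> lmeasurable" unfolding T(3) using meas by (intro fmeasurable.finite_UN) auto
  ultimately have "measure lebesgue S \<noteq> 0" by (simp add: negligible_iff_measure0)
  then have v0: "v \<noteq> 0" using Sv by auto
  have cube: "a m ^ 3 = real k" if m: "m < k" for m
  proof -
    have "measure lebesgue S = a m ^ 3 * v"
      using measure_scaling_image[OF af(1)[OF m] af(2)[OF m] meas[OF m]] af(3)[OF m] v[OF m] by simp
    then show ?thesis using Sv v0 by simp
  qed
  define c where "c = a 0"
  have c: "0 < c" "c ^ 3 = real k" using af(1)[of 0] cube[of 0] k by (auto simp: c_def)
  have ac: "a m = c" if m: "m < k" for m
    by (rule power_eq_imp_eq_base[of _ 3]) (use cube[OF m] c af(1)[OF m] in auto)
  have "\<exists>q h. tetra q h \<and> T m = body q h \<and> (\<forall>r s. c * dist (q r) (q s) = dist (p r) (p s)) \<and> (\<forall>r s. dih h r s = dih g r s)"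
    if m: "m < k" for m
  proof -
    have "f m ` T m = body p g" using af(3)[OF m] Sb by simp
    from similar_preimage[OF af(1)[OF m] af(2)[OF m] this] ac[OF m] show ?thesis by metis
  qed
  then obtain q h where qh: "\<And>m. m < k \<Longrightarrow> tetra (q m) (h m)" "\<And>m. m < k \<Longrightarrow> T m = body (q m) (h m)" 
     "\<And>m r s. m < k \<Longrightarrow> c * dist (q m r) (q m s) = dist (p r) (p s)" "\<And>m r s. m < k \<Longrightarrow> dih (h m) r s = dih g r s"
    by metis
  interpret tiling p g "{..<k}" q h
  proof
    show "body p g = (\<Union>m\<in>{..<k}. body (q m) (h m))" using T(3) Sb qh(2) by simp
    show "interior (body (q m) (h m)) \<inter> interior (body (q n) (h n)) = {}" if "m \<in> {..<k}" "n \<in> {..<k}" "m \<noteq> n" for m n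
      using T(2) that qh(2) by (auto simp: disjoint_family_on_def)
  qed (use qh(1) in \<open>auto simp: tetra_def\<close>)
  show ?thesis by (rule cube_of_scaling_tiling[OF c]) (use qh in auto)
qed

theorem theorem1p1:
  fixes k :: nat
  assumes "k \<ge> 2"
  shows "((\<exists>S. reptile_tetrahedron k S) \<longrightarrow> (\<exists>m::nat. m \<ge> 2 \<and> k = m ^ 3)) \<and>
         (k \<le> 7 \<longrightarrow> \<not> (\<exists>S. reptile_tetrahedron k S))"
proof -
  have *: "\<exists>m::nat. m \<ge> 2 \<and> k = m ^ 3" if S: "reptile_tetrahedron k S" for S
  proof -
    obtain m :: nat where m: "k = m ^ 3" using reptile_count_is_cube[OF assms S] by blast
    have "2 \<le> m"
    proof (rule ccontr)
      assume "\<not> 2 \<le> m"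
      then have "m = 0 \<or> m = 1" by linarith
      then show False using m assms by auto
    qed
    then show ?thesis using m by (intro exI[of _ m]) auto
  qed
  have "8 \<le> m ^ 3" if "2 \<le> m" for m :: nat using power_mono[OF that, of 3] by simp
  with * show ?thesis by fastforce
qed

end
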